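(* Let $A$ be a Prüfer $v$-multiplication domain with quotient field $F \ne A$. Let $V$ be a valuation overring of $A$, and let $P$ be the center of $V$ in $A$. Then the following are equivalent. (1) $V$ is strongly irredundant in some representation of $A$. (2) $V = A_P$, $P \in t\text{-}\mathrm{Max}\,A$ and $P$ is isolated in $t\text{-}\mathrm{Max}\,A$ in the inverse topology. (3) $V = A_P$, $P \in t\text{-}\mathrm{Max}\,A$ and $P$ contains a finitely generated ideal that is not contained in any other $t$-maximal ideal.
   Context: For an ideal $I$ of a domain $A$ with quotient field $F$, $I_v = (A :_F (A :_F I))$ with $(A:_F I) = \{q \in F : qI \subseteq A\}$, and $I_t = \sum_J J_v$, where $J$ ranges over the finitely generated ideals of $A$ contained in $I$. $I$ is a $t$-ideal if $I = I_t$. A $t$-maximal ideal is an ideal maximal among proper $t$-ideals (such ideals are prime); $t\text{-}\mathrm{Max}\,A$ is the set of $t$-maximal ideals. $A$ is a Prüfer $v$-multiplication domain (P$v$MD) if every nonzero finitely generated ideal $I$ of $A$ is $t$-invertible, i.e. $(I(A:_F I))_t = A$; equivalently, $A_M$ is a valuation domain for each $M \in t\text{-}\mathrm{Max}\,A$. A valuation overring of $A$ is a valuation ring $V$ with $A \subseteq V \subseteq F$ (and quotient field $F$); its center in $A$ is $\mathfrak M_V \cap A$, where $\mathfrak M_V$ is the maximal ideal of $V$. The inverse topology on $\mathrm{Spec}\,A$ has as a basis of closed sets the quasicompact Zariski-open subsets; $t\text{-}\mathrm{Max}\,A$ carries the subspace topology. A representation of $A$ is a set $Y$ of valuation overrings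 of $A$ with $A = \bigcap_{V \in Y} V$. A member $V$ of $Y$ is irredundant in $Y$ if $Y\setminus\{V\}$ is not a representation of $A$ (an empty intersection is $F$); it is strongly irredundant in $Y$ if it is irredundant in $Y$ and there is no valuation overring $W$ of $A$ with $V \subsetneq W$ such that $(Y \setminus \{V\}) \cup \{W\}$ is a representation of $A$. *)

theory Defs
  imports
    "HOL-Algebra.Subrings"
    "HOL-Algebra.Ideal_Product"
    "HOL-Analysis.Function_Topology"
begin

text \<open>
  A domain is given as a subring \<open>A\<close> of its quotient field \<open>F\<close>, so that overrings and
  localizations of \<open>A\<close> are subsets of \<open>F\<close>.  Such a subset \<open>B\<close> is viewed as a ring via
  \<open>F\<lparr>carrier := B\<rparr>\<close>.
\<close>

definition quotient_field :: "('a, 'b) ring_scheme \<Rightarrow> 'a set \<Rightarrow> bool" where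
  "quotient_field F A \<longleftrightarrow>
     field F \<and> subdomain A F \<and>
     carrier F = {a \<otimes>\<^bsub>F\<^esub> inv\<^bsub>F\<^esub> b | a b. a \<in> A \<and> b \<in> A - {\<zero>\<^bsub>F\<^esub>}}"

definition fg_ideal :: "('a, 'b) ring_scheme \<Rightarrow> 'a set \<Rightarrow> bool" where
  "fg_ideal R I \<longleftrightarrow> (\<exists>S. finite S \<and> S \<subseteq> carrier R \<and> I = Idl\<^bsub>R\<^esub> S)"

definition localization :: "('a, 'b) ring_scheme \<Rightarrow> 'a set \<Rightarrow> 'a set \<Rightarrow> 'a set" where
  "localization F A P = {a \<otimes>\<^bsub>F\<^esub> inv\<^bsub>F\<^esub> s | a s. a \<in> A \<and> s \<in> A - P}"


subsection \<open>The \<open>v\<close>- and \<open>t\<close>-operations\<close>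

definition colon :: "('a, 'b) ring_scheme \<Rightarrow> 'a set \<Rightarrow> 'a set \<Rightarrow> 'a set" where
  "colon F A I = {q \<in> carrier F. \<forall>x\<in>I. q \<otimes>\<^bsub>F\<^esub> x \<in> A}"

definition v_closure :: "('a, 'b) ring_scheme \<Rightarrow> 'a set \<Rightarrow> 'a set \<Rightarrow> 'a set" where
  "v_closure F A I = colon F A (colon F A I)"

text \<open>
  The sum of the family of ideals \<open>J\<^sub>v\<close> is the ideal generated by their union; note
  that \<open>J \<subseteq> A\<close> implies \<open>J\<^sub>v \<subseteq> A\<close>.
\<close>

definition t_closure :: "('a, 'b) ring_scheme \<Rightarrow> 'a set \<Rightarrow> 'a set \<Rightarrow> 'a set" where
  "t_closure F A I =
     Idl\<^bsub>F\<lparr>carrier := A\<rparr>\<^esub> (\<Union>J \<in> {J. fg_ideal (F\<lparr>carrier := A\<rparr>) J \<and> J \<subseteq> I}. v_closure F A J)"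

definition t_ideal :: "('a, 'b) ring_scheme \<Rightarrow> 'a set \<Rightarrow> 'a set \<Rightarrow> bool" where
  "t_ideal F A I \<longleftrightarrow> ideal I (F\<lparr>carrier := A\<rparr>) \<and> t_closure F A I = I"

definition t_Max :: "('a, 'b) ring_scheme \<Rightarrow> 'a set \<Rightarrow> 'a set set" where
  "t_Max F A = {M. t_ideal F A M \<and> M \<noteq> A \<and>
                   (\<forall>N. t_ideal F A N \<and> N \<noteq> A \<and> M \<subseteq> N \<longrightarrow> N = M)}"

text \<open>
  The second factor of the product below is a fractional ideal, so the product is formed in \<open>F\<close>.
\<close>

definition PvMD :: "('a, 'b) ring_scheme \<Rightarrow> 'a set \<Rightarrow> bool" where
  "PvMD F A \<longleftrightarrow>
     quotient_field F A \<and>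
     (\<forall>I. fg_ideal (F\<lparr>carrier := A\<rparr>) I \<and> I \<noteq> {\<zero>\<^bsub>F\<^esub>} \<longrightarrow>
          t_closure F A (ideal_prod F I (colon F A I)) = A)"


subsection \<open>Valuation overrings and representations\<close>

definition valuation_overring :: "('a, 'b) ring_scheme \<Rightarrow> 'a set \<Rightarrow> 'a set \<Rightarrow> bool" where
  "valuation_overring F A V \<longleftrightarrow>
     subring V F \<and> A \<subseteq> V \<and> (\<forall>x \<in> carrier F - {\<zero>\<^bsub>F\<^esub>}. x \<in> V \<or> inv\<^bsub>F\<^esub> x \<in> V)"

definition center :: "('a, 'b) ring_scheme \<Rightarrow> 'a set \<Rightarrow> 'a set \<Rightarrow> 'a set" where
  "center F A V = (THE M. maximalideal M (F\<lparr>carrier := V\<rparr>)) \<inter> A"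

text \<open>The factor \<open>carrier F\<close> makes the empty intersection equal to \<open>F\<close>.\<close>

definition representation :: "('a, 'b) ring_scheme \<Rightarrow> 'a set \<Rightarrow> 'a set set \<Rightarrow> bool" where
  "representation F A Y \<longleftrightarrow> (\<forall>V\<in>Y. valuation_overring F A V) \<and> A = carrier F \<inter> \<Inter>Y"

definition irredundant :: "('a, 'b) ring_scheme \<Rightarrow> 'a set \<Rightarrow> 'a set set \<Rightarrow> 'a set \<Rightarrow> bool" where
  "irredundant F A Y V \<longleftrightarrow> V \<in> Y \<and> \<not> representation F A (Y - {V})"

definition strongly_irredundant ::
    "('a, 'b) ring_scheme \<Rightarrow> 'a set \<Rightarrow> 'a set set \<Rightarrow> 'a set \<Rightarrow> bool" where
  "strongly_irredundant F A Y V \<longleftrightarrow>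
     irredundant F A Y V \<and>
     \<not> (\<exists>W. valuation_overring F A W \<and> V \<subset> W \<and> representation F A ((Y - {V}) \<union> {W}))"


subsection \<open>Zariski and inverse topologies\<close>

definition Spec :: "('a, 'b) ring_scheme \<Rightarrow> 'a set set" where
  "Spec R = {P. primeideal P R}"

definition zariski_topology :: "('a, 'b) ring_scheme \<Rightarrow> 'a set topology" where
  "zariski_topology R = topology_generated_by ((\<lambda>a. {P \<in> Spec R. a \<notin> P}) ` carrier R)"

text \<open>
  The quasicompact Zariski-open sets are closed under finite unions and include the empty set.
  Hence their complements, which are taken below as a subbasis of open sets, form a basis of
  open sets of \<open>Spec R\<close>; that is, the quasicompact open sets form a basis of closed sets.
\<close>

definition inverse_topology :: "('a, 'b) ring_scheme \<Rightarrow> 'a set topology" where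
  "inverse_topology R =
     topology_generated_by
       {Spec R - U | U. openin (zariski_topology R) U \<and> compactin (zariski_topology R) U}"

definition isolated_in_t_Max :: "('a, 'b) ring_scheme \<Rightarrow> 'a set \<Rightarrow> 'a set \<Rightarrow> bool" where
  "isolated_in_t_Max F A P \<longleftrightarrow>
     openin (subtopology (inverse_topology (F\<lparr>carrier := A\<rparr>)) (t_Max F A)) {P}"

end

theory Submission
  imports Defs
begin

text \<open>
  A PvMD \<open>A\<close> is the intersection of the valuation rings \<open>A\<^sub>M\<close>, \<open>M\<close> ranging over the t-maximal
  ideals, and no valuation overring of \<open>A\<close> lies in two of them.

  If \<open>V\<close> is strongly irredundant in \<open>Y\<close>, let \<open>B\<close> be the intersection of the other members.  If
  \<open>x \<in> B\<close> is not in \<open>A\<^sub>M\<close>, then comparing \<open>x\<close> with the elements of \<open>V\<close> in the valuation ring \<open>A\<^sub>M\<close> gives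
  \<open>V \<subseteq> A\<^sub>M\<close>; hence \<open>B \<subseteq> A\<^sub>N\<close> for all \<open>N\<close> but one \<open>M\<close>, and strong irredundance forces \<open>V = A\<^sub>M\<close>.
  For \<open>x \<in> B - A\<close>, written as \<open>x = a/b\<close>, t-invertibility of \<open>(a, b)\<close> yields a finite
  subset of \<open>{s \<in> A. s x \<in> A}\<close> that lies in no t-maximal ideal other than \<open>M\<close>.

  Conversely, if \<open>P\<close> is the only t-maximal ideal containing the finite set \<open>S\<close>, and \<open>a \<in> P\<close> is
  nonzero, then t-invertibility of \<open>(S, a)\<close> gives an element \<open>k\<close> outside \<open>A\<close> that lies in all other
  \<open>A\<^sub>M\<close> and in \<open>a\<^sup>-\<^sup>1 A\<close>.  Choosing \<open>a\<close> invertible in \<open>W\<close>, the ring \<open>A\<^sub>P\<close> cannot be replaced by a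
  larger \<open>W\<close> in the representation by the rings \<open>A\<^sub>M\<close>.
\<close>

section \<open>Finitary closure operations\<close>

text \<open>Only finite subsets are tested, so the property passes to unions of chains and Zorn's
  lemma applies. For \<open>c = v_closure F A\<close> the closed subsets of \<open>A\<close> are
  exactly the t-ideals, see \<open>t_ideal_iff\<close>.\<close>

definition finitary_closed :: "('a set \<Rightarrow> 'a set) \<Rightarrow> 'a set \<Rightarrow> bool" where
  "finitary_closed c M \<longleftrightarrow> (\<forall>T. finite T \<and> T \<subseteq> M \<longrightarrow> c T \<subseteq> M)"

text \<open>The finite subsets of \<open>M\<close> are directed: witnesses for the single elements
  of \<open>S\<close> merge into their union. Monotonicity is asked only for finite \<open>U\<close>
  inside \<open>M\<close>, the range in which the axioms of a closure operation on finite sets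
  provide it.\<close>

lemma finite_subset_directed_Union:
  assumes "finite S" "S \<subseteq> (\<Union>T\<in>{T. finite T \<and> T \<subseteq> M}. g T)"
    and mono: "\<And>T U. finite U \<Longrightarrow> T \<subseteq> U \<Longrightarrow> U \<subseteq> M \<Longrightarrow> g T \<subseteq> g U"
  obtains T where "finite T" "T \<subseteq> M" "S \<subseteq> g T"
proof -
  have "\<exists>T. finite T \<and> T \<subseteq> M \<and> S \<subseteq> g T"
    using assms(1,2)
  proof (induction S rule: finite_induct)
    case empty
    then show ?case by blast
  next
    case (insert x S)
    then obtain T where T: "finite T" "T \<subseteq> M" "S \<subseteq> g T" by auto
    from insert obtain U where U: "finite U" "U \<subseteq> M" "x \<in> g U" by auto
    have "g T \<subseteq> g (T \<union> U)" "g U \<subseteq> g (T \<union> U)"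
      by (rule mono; use T U in blast)+
    then have "insert x S \<subseteq> g (T \<union> U)" using T U by blast
    then show ?case using T U by (metis finite_Un le_sup_iff)
  qed
  then show ?thesis using that by blast
qed

text \<open>
  With the v-closure for \<open>c\<close> this yields t-maximal ideals, and with
  \<open>c T\<close> the intersection of the primes containing \<open>T\<close> it yields the quasicompactness of basic open sets.
\<close>

lemma maximal_finitary_closed:
  assumes ext: "\<And>T. finite T \<Longrightarrow> T \<subseteq> A \<Longrightarrow> T \<subseteq> c T"
    and cA: "\<And>T. finite T \<Longrightarrow> T \<subseteq> A \<Longrightarrow> c T \<subseteq> A"
    and idem: "\<And>S T. finite S \<Longrightarrow> finite T \<Longrightarrow> T \<subseteq> A \<Longrightarrow> S \<subseteq> c T \<Longrightarrow> c S \<subseteq> c T"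
    and I: "I \<subseteq> A" "finitary_closed c I" "e \<notin> I"
  obtains M where "I \<subseteq> M" "M \<subseteq> A" "finitary_closed c M" "e \<notin> M"
    "\<forall>x\<in>A - M. \<exists>T. finite T \<and> T \<subseteq> M \<and> e \<in> c (insert x T)"
proof -
  define \<M> where "\<M> = {M. I \<subseteq> M \<and> M \<subseteq> A \<and> finitary_closed c M \<and> e \<notin> M}"
  have "\<exists>M\<in>\<M>. \<forall>N\<in>\<M>. M \<subseteq> N \<longrightarrow> N = M"
  proof (rule subset_Zorn_nonempty)
    show "\<M> \<noteq> {}" using I by (auto simp: \<M>_def)
  next
    fix \<C> assume C: "\<C> \<noteq> {}" "subset.chain \<M> \<C>"
    then have sub: "\<C> \<subseteq> \<M>" by (simp add: subset_chain_def)
    have "c T \<subseteq> \<Union>\<C>" if T: "finite T" "T \<subseteq> \<Union>\<C>" for T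
    proof -
      obtain N where "N \<in> \<C>" "T \<subseteq> N"
        using finite_subset_Union_chain[OF T C] by blast
      then have "finitary_closed c N" using sub by (auto simp: \<M>_def)
      then have "c T \<subseteq> N" using T(1) \<open>T \<subseteq> N\<close> by (simp add: finitary_closed_def)
      then show ?thesis using \<open>N \<in> \<C>\<close> by blast
    qed
    then have "finitary_closed c (\<Union>\<C>)" by (simp add: finitary_closed_def)
    moreover have "I \<subseteq> \<Union>\<C>" "\<Union>\<C> \<subseteq> A" "e \<notin> \<Union>\<C>" using sub C(1) unfolding \<M>_def by blast+
    ultimately show "\<Union>\<C> \<in> \<M>" by (simp add: \<M>_def)
  qed
  then obtain M where M: "M \<in> \<M>" and max: "\<And>N. N \<in> \<M> \<Longrightarrow> M \<subseteq> N \<Longrightarrow> N = M" by blast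
  have MA: "M \<subseteq> A" using M by (simp add: \<M>_def)
  have "\<exists>T. finite T \<and> T \<subseteq> M \<and> e \<in> c (insert x T)" if x: "x \<in> A - M" for x
  proof (rule ccontr)
    assume no: "\<not> ?thesis"
    \<comment> \<open>\<open>N\<close> is the closed set generated by \<open>M\<close> and
      \<open>x\<close>. The negated claim keeps \<open>e\<close> outside \<open>N\<close>, which
      contradicts the maximality of \<open>M\<close>.\<close>
    define N where "N = (\<Union>T\<in>{T. finite T \<and> T \<subseteq> M}. c (insert x T))"
    have NA: "N \<subseteq> A"
      unfolding N_def using x MA by (intro UN_least cA) auto
    have "c S \<subseteq> N" if S: "finite S" "S \<subseteq> N" for S
    proof -
      obtain T where T: "finite T" "T \<subseteq> M" "S \<subseteq> c (insert x T)"
      proof (rule finite_subset_directed_Union[where g = "\<lambda>T. c (insert x T)"])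
        show "S \<subseteq> (\<Union>T\<in>{T. finite T \<and> T \<subseteq> M}. c (insert x T))" using S by (simp add: N_def)
        show "c (insert x T) \<subseteq> c (insert x U)" if U: "finite U" "T \<subseteq> U" "U \<subseteq> M" for T U
        proof (rule idem)
          have "insert x U \<subseteq> c (insert x U)" using U x MA by (intro ext) auto
          then show "insert x T \<subseteq> c (insert x U)" using U by blast
          show "finite (insert x T)" using U by (simp add: finite_subset)
        qed (use U x MA in auto)
      qed (use S in auto)
      have "c S \<subseteq> c (insert x T)" using S T x MA by (intro idem) auto
      also have "\<dots> \<subseteq> N" unfolding N_def by (rule UN_upper) (use T in simp)
      finally show ?thesis .
    qed
    then have "finitary_closed c N" by (simp add: finitary_closed_def)
    moreover have "insert x M \<subseteq> N"
    proof
      fix y assume y: "y \<in> insert x M"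
      \<comment> \<open>The finite set \<open>T\<close> in the definition of \<open>N\<close> must
        lie in \<open>M\<close>, and \<open>x\<close> does not, so the case \<open>y = x\<close>
        uses \<open>T = {}\<close>.\<close>
      have "{x, y} \<subseteq> c (insert x (if y = x then {} else {y}))"
        using ext[of "insert x (if y = x then {} else {y})"] x y MA by auto
      moreover have "c (insert x (if y = x then {} else {y})) \<subseteq> N"
        unfolding N_def by (rule UN_upper) (use y in auto)
      ultimately show "y \<in> N" by blast
    qed
    moreover have "e \<notin> N" using no by (auto simp: N_def)
    ultimately have "N \<in> \<M>" using M NA by (auto simp: \<M>_def)
    then show False using max \<open>insert x M \<subseteq> N\<close> x by blast
  qed
  then have "\<forall>x\<in>A - M. \<exists>T. finite T \<and> T \<subseteq> M \<and> e \<in> c (insert x T)" ..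
  then show ?thesis
    by (rule that[rotated 4]) (use M in \<open>simp_all add: \<M>_def\<close>)
qed

section \<open>Ideals and localizations inside the quotient field\<close>

locale fraction_field = field F for F (structure) +
  fixes A :: "'a set"
  assumes quotient_field: "quotient_field F A"
begin

lemma subdomain_A: "subdomain A F" and
  fraction: "x \<in> carrier F \<Longrightarrow> \<exists>a\<in>A. \<exists>b\<in>A - {\<zero>}. x = a \<otimes> inv b"
  using quotient_field by (auto simp: quotient_field_def)

lemma subring_A: "subring A F"
  using subdomain_A by (simp add: subdomain_def subcring_def)

lemma A_carr [simp, intro]: "x \<in> A \<Longrightarrow> x \<in> carrier F"
  using subringE(1)[OF subring_A] by blast

lemmas A_closed [simp, intro] =
  subringE(2)[OF subring_A] subringE(3)[OF subring_A]
  subringE(6)[OF subring_A] subringE(7)[OF subring_A] subringE(5)[OF subring_A]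

section \<open>Arithmetic of inverses in the quotient field\<close>

lemma inv_carr [simp, intro]: "x \<in> carrier F \<Longrightarrow> x \<noteq> \<zero> \<Longrightarrow> inv x \<in> carrier F"
  using field_Units by auto

lemma inv_r [simp]: "x \<in> carrier F \<Longrightarrow> x \<noteq> \<zero> \<Longrightarrow> x \<otimes> inv x = \<one>"
  using field_Units by auto

lemma inv_l [simp]: "x \<in> carrier F \<Longrightarrow> x \<noteq> \<zero> \<Longrightarrow> inv x \<otimes> x = \<one>"
  using field_Units by auto

lemma inv_nonzero [simp]: "x \<in> carrier F \<Longrightarrow> x \<noteq> \<zero> \<Longrightarrow> inv x \<noteq> \<zero>"
  by (metis inv_r r_null zero_not_one)

lemma mult_inv_cancel [simp]:
  "x \<in> carrier F \<Longrightarrow> y \<in> carrier F \<Longrightarrow> x \<noteq> \<zero> \<Longrightarrow> x \<otimes> (inv x \<otimes> y) = y"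
  "x \<in> carrier F \<Longrightarrow> y \<in> carrier F \<Longrightarrow> x \<noteq> \<zero> \<Longrightarrow> inv x \<otimes> (x \<otimes> y) = y"
  by (simp_all flip: m_assoc)

lemma inv_eqI: "x \<in> carrier F \<Longrightarrow> y \<in> carrier F \<Longrightarrow> x \<otimes> y = \<one> \<Longrightarrow> inv x = y"
  using inv_unique'[of x y] m_comm[of x y] by simp

lemma inv_mult:
  assumes "x \<in> carrier F" "y \<in> carrier F" "x \<noteq> \<zero>" "y \<noteq> \<zero>"
  shows "inv (x \<otimes> y) = inv x \<otimes> inv y"
proof (rule inv_eqI)
  have "x \<otimes> y \<otimes> (inv x \<otimes> inv y) = (x \<otimes> inv x) \<otimes> (y \<otimes> inv y)"
    using assms by (simp del: inv_r mult_inv_cancel add: m_ac)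
  then show "x \<otimes> y \<otimes> (inv x \<otimes> inv y) = \<one>" using assms by simp
qed (use assms in auto)

lemma inv_divide:
  assumes "x \<in> carrier F" "y \<in> carrier F" "x \<noteq> \<zero>" "y \<noteq> \<zero>"
  shows "inv (x \<otimes> inv y) = y \<otimes> inv x"
proof -
  have "inv (inv y) = y" using assms by (intro inv_eqI) auto
  then show ?thesis using assms by (simp add: inv_mult m_comm)
qed

section \<open>Ideals of subrings, described with the operations of \<open>F\<close>\<close>

abbreviation R where "R \<equiv> F\<lparr>carrier := A\<rparr>"

lemma subring_cring: "subring B F \<Longrightarrow> cring (F\<lparr>carrier := B\<rparr>)"
  using subring_is_domain domain.axioms(1) by blast

text \<open>Closure under negation comes from multiplying by minus one, which lies in
  \<open>B\<close>. The general subring \<open>B\<close> covers both \<open>A\<close> and the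
  valuation ring in \<open>center_eq\<close>.\<close>

lemma subring_ideal_iff:
  assumes B: "subring B F"
  shows "ideal I (F\<lparr>carrier := B\<rparr>) \<longleftrightarrow>
    I \<subseteq> B \<and> \<zero> \<in> I \<and> (\<forall>x\<in>I. \<forall>y\<in>I. x \<oplus> y \<in> I) \<and> (\<forall>a\<in>B. \<forall>x\<in>I. a \<otimes> x \<in> I)"
    (is "?L \<longleftrightarrow> ?R")
proof
  assume ?L
  then interpret I: ideal I "F\<lparr>carrier := B\<rparr>" .
  show ?R
    using I.a_subset additive_subgroup.zero_closed[OF I.additive_subgroup_axioms]
      additive_subgroup.a_closed[OF I.additive_subgroup_axioms] I.I_l_closed by simp
next
  assume r: ?R
  interpret B: cring "F\<lparr>carrier := B\<rparr>" by (rule subring_cring[OF B])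
  have BF: "B \<subseteq> carrier F" using subringE(1)[OF B] .
  show ?L
  proof (rule idealI)
    show "ring (F\<lparr>carrier := B\<rparr>)" by (rule B.ring_axioms)
    show "subgroup I (add_monoid (F\<lparr>carrier := B\<rparr>))"
    proof (rule B.add.subgroupI)
      show "I \<subseteq> carrier (F\<lparr>carrier := B\<rparr>)" using r by simp
      show "I \<noteq> {}" using r by auto
    next
      fix a assume a: "a \<in> I"
      then have aB: "a \<in> carrier (F\<lparr>carrier := B\<rparr>)" using r by auto
      have "(\<ominus>\<^bsub>F\<lparr>carrier := B\<rparr>\<^esub> \<one>\<^bsub>F\<lparr>carrier := B\<rparr>\<^esub>) \<otimes>\<^bsub>F\<lparr>carrier := B\<rparr>\<^esub> a \<in> I"
        using r a B.a_inv_closed[OF B.one_closed] by simp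
      moreover have "(\<ominus>\<^bsub>F\<lparr>carrier := B\<rparr>\<^esub> \<one>\<^bsub>F\<lparr>carrier := B\<rparr>\<^esub>) \<otimes>\<^bsub>F\<lparr>carrier := B\<rparr>\<^esub> a
          = \<ominus>\<^bsub>F\<lparr>carrier := B\<rparr>\<^esub> a"
        using B.l_minus[OF B.one_closed aB] B.l_one[OF aB] by simp
      ultimately show "\<ominus>\<^bsub>F\<lparr>carrier := B\<rparr>\<^esub> a \<in> I" by simp
    next
      fix a b assume "a \<in> I" "b \<in> I"
      then show "a \<oplus>\<^bsub>F\<lparr>carrier := B\<rparr>\<^esub> b \<in> I" using r by simp
    qed
    show "x \<otimes>\<^bsub>F\<lparr>carrier := B\<rparr>\<^esub> a \<in> I"
      if "a \<in> I" "x \<in> carrier (F\<lparr>carrier := B\<rparr>)" for a x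
      using r that by simp
    then show "a \<otimes>\<^bsub>F\<lparr>carrier := B\<rparr>\<^esub> x \<in> I"
      if "a \<in> I" "x \<in> carrier (F\<lparr>carrier := B\<rparr>)" for a x
      using r that B.m_comm[of a x] by auto
  qed
qed

lemmas ideal_iff = subring_ideal_iff[OF subring_A]

lemma idealD:
  assumes "ideal I R"
  shows "I \<subseteq> A" "\<zero> \<in> I"
    and "x \<in> I \<Longrightarrow> y \<in> I \<Longrightarrow> x \<oplus> y \<in> I"
    and "a \<in> A \<Longrightarrow> x \<in> I \<Longrightarrow> a \<otimes> x \<in> I"
    and "a \<in> A \<Longrightarrow> x \<in> I \<Longrightarrow> x \<otimes> a \<in> I"
  using assms m_comm[of x a] unfolding ideal_iff by auto

lemma prime_iff:
  "primeideal P R \<longleftrightarrow> ideal P R \<and> P \<noteq> A \<and> (\<forall>a\<in>A. \<forall>b\<in>A. a \<otimes> b \<in> P \<longrightarrow> a \<in> P \<or> b \<in> P)"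
proof
  assume "primeideal P R"
  then interpret P: primeideal P R .
  show "ideal P R \<and> P \<noteq> A \<and> (\<forall>a\<in>A. \<forall>b\<in>A. a \<otimes> b \<in> P \<longrightarrow> a \<in> P \<or> b \<in> P)"
    using P.ideal_axioms P.I_notcarr P.I_prime by auto
next
  assume "ideal P R \<and> P \<noteq> A \<and> (\<forall>a\<in>A. \<forall>b\<in>A. a \<otimes> b \<in> P \<longrightarrow> a \<in> P \<or> b \<in> P)"
  then show "primeideal P R"
    by (intro primeidealI) (auto simp: subring_cring[OF subring_A])
qed

lemma ideal_proper_iff: "ideal I R \<Longrightarrow> I \<noteq> A \<longleftrightarrow> \<one> \<notin> I"
  unfolding ideal_iff using A_closed r_one by (metis A_carr subset_antisym subsetI)

lemma Idl_ideal: "S \<subseteq> A \<Longrightarrow> ideal (Idl\<^bsub>R\<^esub> S) R"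
  using ring.genideal_ideal[OF subring_is_ring[OF subring_A]] by simp

lemma Idl_subset_iff:
  assumes "S \<subseteq> A" "ideal I R"
  shows "Idl\<^bsub>R\<^esub> S \<subseteq> I \<longleftrightarrow> S \<subseteq> I"
  using ring.genideal_self[OF subring_is_ring[OF subring_A], of S]
    ring.genideal_minimal[OF subring_is_ring[OF subring_A], of I S] assms by auto

lemma subset_Idl: "S \<subseteq> A \<Longrightarrow> S \<subseteq> Idl\<^bsub>R\<^esub> S"
  using ring.genideal_self[OF subring_is_ring[OF subring_A], of S] by simp

lemma colon_Idl:
  assumes S: "S \<subseteq> A"
  shows "colon F A (Idl\<^bsub>R\<^esub> S) = colon F A S"
proof -
  have "q \<in> colon F A (Idl\<^bsub>R\<^esub> S) \<longleftrightarrow> q \<in> colon F A S" for q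
  proof (cases "q \<in> carrier F")
    case True
    have "ideal {y \<in> A. q \<otimes> y \<in> A} R"
      unfolding ideal_iff using True by (auto simp: r_distr m_lcomm)
    from Idl_subset_iff[OF S this] show ?thesis
      using True S subset_Idl[OF S] Idl_ideal[OF S] by (auto simp: colon_def ideal_iff subset_iff)
  qed (simp add: colon_def)
  then show ?thesis by blast
qed

lemma v_closure_Idl: "S \<subseteq> A \<Longrightarrow> v_closure F A (Idl\<^bsub>R\<^esub> S) = v_closure F A S"
  by (simp add: v_closure_def colon_Idl)

text \<open>Clearing the denominator replaces fractions by products in \<open>A\<close>. The
  assumption on \<open>P\<close> makes every element of \<open>A - P\<close> invertible in
  \<open>F\<close>.\<close>

lemma mem_localization_iff:
  assumes "\<zero> \<in> P"
  shows "x \<in> localization F A P \<longleftrightarrow> x \<in> carrier F \<and> (\<exists>s\<in>A - P. s \<otimes> x \<in> A)"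
proof
  assume "x \<in> localization F A P"
  then obtain a s where as: "a \<in> A" "s \<in> A - P" "x = a \<otimes> inv s" by (auto simp: localization_def)
  then have "s \<noteq> \<zero>" using assms by auto
  then have "s \<otimes> x = a" "x \<in> carrier F" using as by (simp_all add: m_lcomm)
  then show "x \<in> carrier F \<and> (\<exists>s\<in>A - P. s \<otimes> x \<in> A)" using as by metis
next
  assume "x \<in> carrier F \<and> (\<exists>s\<in>A - P. s \<otimes> x \<in> A)"
  then obtain s where s: "x \<in> carrier F" "s \<in> A - P" "s \<otimes> x \<in> A" by blast
  then have "s \<noteq> \<zero>" using assms by auto
  then have "x = (s \<otimes> x) \<otimes> inv s" using s m_comm[of "s \<otimes> x" "inv s"] by simp
  then show "x \<in> localization F A P" using s unfolding localization_def by blast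
qed

section \<open>The v-operation on finite sets\<close>

lemma v_closure_subset_A: "T \<subseteq> A \<Longrightarrow> v_closure F A T \<subseteq> A"
proof
  fix x assume T: "T \<subseteq> A" and x: "x \<in> v_closure F A T"
  have "\<one> \<in> colon F A T" using T by (auto simp: colon_def)
  then have "x \<otimes> \<one> \<in> A" "x \<in> carrier F" using x by (auto simp: v_closure_def colon_def)
  then show "x \<in> A" by simp
qed

lemma subset_v_closure: "T \<subseteq> A \<Longrightarrow> T \<subseteq> v_closure F A T"
  by (auto simp: v_closure_def colon_def m_comm subset_iff)

text \<open>Every \<open>q\<close> in \<open>colon F A T\<close> multiplies \<open>S\<close> into
  \<open>A\<close>, and a second colon reverses the inclusion. Together with
  \<open>subset_v_closure\<close> this makes the v-operation a closure operation.\<close>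

lemma v_closure_subset:
  assumes "S \<subseteq> A" "S \<subseteq> v_closure F A T"
  shows "v_closure F A S \<subseteq> v_closure F A T"
proof -
  have "colon F A T \<subseteq> colon F A S"
  proof
    fix q assume q: "q \<in> colon F A T"
    have "q \<otimes> x \<in> A" if "x \<in> S" for x
    proof -
      have "x \<otimes> q \<in> A" using assms that q by (auto simp: v_closure_def colon_def)
      then show ?thesis using assms that q m_comm[of q x] by (auto simp: colon_def)
    qed
    then show "q \<in> colon F A S" using q by (simp add: colon_def)
  qed
  then show ?thesis unfolding v_closure_def by (auto simp: colon_def)
qed

lemma v_closure_mono: "S \<subseteq> T \<Longrightarrow> v_closure F A S \<subseteq> v_closure F A T"
  unfolding v_closure_def colon_def by auto

lemma v_closure_ideal: "T \<subseteq> A \<Longrightarrow> ideal (v_closure F A T) R"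
  unfolding ideal_iff using v_closure_subset_A[of T]
  by (auto simp: v_closure_def colon_def l_distr m_assoc)

lemma one_in_v_closure_iff: "T \<subseteq> A \<Longrightarrow> \<one> \<in> v_closure F A T \<longleftrightarrow> colon F A T \<subseteq> A"
  by (auto simp: v_closure_def colon_def)

text \<open>If \<open>q\<close> multiplies \<open>x \<otimes> y\<close> and \<open>T\<close> into
  \<open>A\<close>, then \<open>q \<otimes> y\<close> does so with \<open>x\<close> and
  \<open>T\<close>, hence lies in \<open>A\<close>. Now \<open>q\<close> does so with
  \<open>y\<close> and \<open>T\<close>, hence lies in \<open>A\<close>. This is the multiplicative
  step behind the primeness of t-maximal ideals.\<close>

lemma one_in_v_closure_mult:
  assumes "T \<subseteq> A" "x \<in> A" "y \<in> A"
    and "\<one> \<in> v_closure F A (insert x T)" "\<one> \<in> v_closure F A (insert y T)"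
  shows "\<one> \<in> v_closure F A (insert (x \<otimes> y) T)"
proof -
  have "q \<in> A" if q: "q \<in> colon F A (insert (x \<otimes> y) T)" for q
  proof -
    have qF: "q \<in> carrier F" and qxy: "q \<otimes> (x \<otimes> y) \<in> A" and qT: "\<And>t. t \<in> T \<Longrightarrow> q \<otimes> t \<in> A"
      using q by (auto simp: colon_def)
    have "(q \<otimes> y) \<otimes> t \<in> A" if "t \<in> T" for t
    proof -
      have "t \<in> carrier F" using that assms(1) by auto
      then have "(q \<otimes> y) \<otimes> t = y \<otimes> (q \<otimes> t)" using qF assms(3) by (simp add: m_ac)
      then show ?thesis using qT[OF that] assms(3) by simp
    qed
    moreover have "(q \<otimes> y) \<otimes> x \<in> A" using qxy qF assms by (simp add: m_ac)
    ultimately have "q \<otimes> y \<in> colon F A (insert x T)" using qF assms by (auto simp: colon_def)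
    then have "q \<otimes> y \<in> A" using assms one_in_v_closure_iff[of "insert x T"] by auto
    then have "q \<in> colon F A (insert y T)" using qF qT by (auto simp: colon_def)
    then show "q \<in> A" using assms one_in_v_closure_iff[of "insert y T"] by auto
  qed
  then show ?thesis using assms one_in_v_closure_iff[of "insert (x \<otimes> y) T"] by auto
qed

section \<open>t-maximal ideals\<close>

text \<open>The union is directed, so it is already an ideal, and it contains every
  \<open>J\<^sub>v\<close>. Membership in a t-closure is therefore witnessed by one finite set.
  \<open>I\<close> is an arbitrary subset of \<open>A\<close>, so the product in the definition of
  \<open>PvMD\<close> can be inserted directly.\<close>

lemma t_closure_subset_Union:
  assumes "I \<subseteq> A"
  shows "t_closure F A I \<subseteq> (\<Union>T\<in>{T. finite T \<and> T \<subseteq> I}. v_closure F A T)" (is "_ \<subseteq> ?N")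
proof -
  have "ideal ?N R"
    unfolding ideal_iff
  proof (intro conjI ballI)
    show "?N \<subseteq> A" using v_closure_subset_A assms by blast
    show "\<zero> \<in> ?N"
      using v_closure_ideal[of "{}"] by (intro UN_I[of "{}"]) (auto simp: ideal_iff)
    show "x \<oplus> y \<in> ?N" if xy: "x \<in> ?N" "y \<in> ?N" for x y
    proof -
      from xy obtain T U where T: "finite T" "T \<subseteq> I" "x \<in> v_closure F A T"
        and U: "finite U" "U \<subseteq> I" "y \<in> v_closure F A U" by auto
      have "x \<in> v_closure F A (T \<union> U)" "y \<in> v_closure F A (T \<union> U)"
        using T U v_closure_mono[of T "T \<union> U"] v_closure_mono[of U "T \<union> U"] by auto
      then have "x \<oplus> y \<in> v_closure F A (T \<union> U)"
        using v_closure_ideal[of "T \<union> U"] T U assms by (auto simp: ideal_iff)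
      then show ?thesis using T U by (intro UN_I[of "T \<union> U"]) auto
    qed
    show "a \<otimes> x \<in> ?N" if ax: "a \<in> A" "x \<in> ?N" for a x
    proof -
      from ax obtain T where T: "finite T" "T \<subseteq> I" "x \<in> v_closure F A T" by auto
      then have "a \<otimes> x \<in> v_closure F A T"
        using v_closure_ideal[of T] assms ax by (auto simp: ideal_iff)
      then show ?thesis using T by auto
    qed
  qed
  moreover have "(\<Union>J \<in> {J. fg_ideal R J \<and> J \<subseteq> I}. v_closure F A J) \<subseteq> ?N"
  proof
    fix x assume "x \<in> (\<Union>J \<in> {J. fg_ideal R J \<and> J \<subseteq> I}. v_closure F A J)"
    then obtain S where S: "finite S" "S \<subseteq> A" "Idl\<^bsub>R\<^esub> S \<subseteq> I" "x \<in> v_closure F A (Idl\<^bsub>R\<^esub> S)"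
      by (auto simp: fg_ideal_def)
    then show "x \<in> ?N" using subset_Idl[of S] v_closure_Idl[of S] by auto
  qed
  moreover have "?N \<subseteq> A" using v_closure_subset_A assms by blast
  ultimately show ?thesis
    unfolding t_closure_def using Idl_subset_iff by (meson order_trans)
qed

lemma v_closure_subset_t_closure:
  assumes I: "ideal I R" and T: "finite T" "T \<subseteq> I"
  shows "v_closure F A T \<subseteq> t_closure F A I"
proof -
  have TA: "T \<subseteq> A" and IA: "I \<subseteq> A" using assms by (auto simp: ideal_iff)
  have "Idl\<^bsub>R\<^esub> T \<in> {J. fg_ideal R J \<and> J \<subseteq> I}"
    using T TA Idl_subset_iff[OF TA I] by (auto simp: fg_ideal_def)
  then have "v_closure F A T \<subseteq> (\<Union>J \<in> {J. fg_ideal R J \<and> J \<subseteq> I}. v_closure F A J)"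
    using v_closure_Idl[OF TA] by blast
  also have "\<dots> \<subseteq> t_closure F A I"
    unfolding t_closure_def
    by (rule subset_Idl) (use v_closure_subset_A IA in blast)
  finally show ?thesis .
qed

text \<open>This makes \<open>maximal_finitary_closed\<close> applicable to t-ideals. From right to
  left, the ideal axioms are read off from the v-closures of the empty set, of pairs and of
  singletons, each of which is an ideal inside \<open>I\<close>.\<close>

lemma t_ideal_iff: "t_ideal F A I \<longleftrightarrow> I \<subseteq> A \<and> finitary_closed (v_closure F A) I"
proof
  assume I: "t_ideal F A I"
  then have "ideal I R" "t_closure F A I = I" by (auto simp: t_ideal_def)
  then show "I \<subseteq> A \<and> finitary_closed (v_closure F A) I"
    using v_closure_subset_t_closure unfolding finitary_closed_def ideal_iff by metis
next
  assume I: "I \<subseteq> A \<and> finitary_closed (v_closure F A) I"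
  then have c: "v_closure F A T \<subseteq> I" if "finite T" "T \<subseteq> I" for T
    using that by (simp add: finitary_closed_def)
  have "ideal I R"
    unfolding ideal_iff
  proof (intro conjI ballI)
    show "I \<subseteq> A" using I by simp
    show "\<zero> \<in> I" using c[of "{}"] v_closure_ideal[of "{}"] by (auto simp: ideal_iff)
    show "x \<oplus> y \<in> I" if "x \<in> I" "y \<in> I" for x y
    proof -
      have "{x, y} \<subseteq> A" using that I by auto
      then have "x \<oplus> y \<in> v_closure F A {x, y}"
        using idealD(3)[OF v_closure_ideal, of "{x, y}" x y] subset_v_closure[of "{x, y}"] by simp
      then show ?thesis using c[of "{x, y}"] that by auto
    qed
    show "a \<otimes> x \<in> I" if "a \<in> A" "x \<in> I" for a x
    proof -
      have "{x} \<subseteq> A" using that I by auto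
      then have "a \<otimes> x \<in> v_closure F A {x}"
        using idealD(4)[OF v_closure_ideal, of "{x}" a x] subset_v_closure[of "{x}"] that by simp
      then show ?thesis using c[of "{x}"] that by auto
    qed
  qed
  moreover have "t_closure F A I \<subseteq> I"
    using t_closure_subset_Union[of I] I c by blast
  moreover have "x \<in> t_closure F A I" if "x \<in> I" for x
    using v_closure_subset_t_closure[OF \<open>ideal I R\<close>, of "{x}"] subset_v_closure[of "{x}"] that I by auto
  ultimately show "t_ideal F A I" by (auto simp: t_ideal_def)
qed

lemma t_ideal_ideal: "t_ideal F A I \<Longrightarrow> ideal I R"
  by (simp add: t_ideal_def)

lemma t_ideal_v_closure: "t_ideal F A I \<Longrightarrow> finite T \<Longrightarrow> T \<subseteq> I \<Longrightarrow> v_closure F A T \<subseteq> I"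
  by (simp add: t_ideal_iff finitary_closed_def)

lemma t_ideal_proper_iff: "t_ideal F A I \<Longrightarrow> I \<noteq> A \<longleftrightarrow> \<one> \<notin> I"
  by (simp add: t_ideal_ideal ideal_proper_iff)

text \<open>Zorn's lemma with \<open>e = \<one>\<close>. The last conclusion is maximality in
  finitary form, which the proof of primeness uses.\<close>

lemma t_ideal_maximal:
  assumes I: "t_ideal F A I" "\<one> \<notin> I"
  obtains M where "I \<subseteq> M" "M \<in> t_Max F A"
    "\<forall>x\<in>A - M. \<exists>T. finite T \<and> T \<subseteq> M \<and> \<one> \<in> v_closure F A (insert x T)"
proof -
  obtain M where M: "I \<subseteq> M" "M \<subseteq> A" "finitary_closed (v_closure F A) M" "\<one> \<notin> M"
    and max: "\<forall>x\<in>A - M. \<exists>T. finite T \<and> T \<subseteq> M \<and> \<one> \<in> v_closure F A (insert x T)"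
  proof (rule maximal_finitary_closed[of A "v_closure F A" I \<one>])
    show "v_closure F A S \<subseteq> v_closure F A T"
      if "finite S" "finite T" "T \<subseteq> A" "S \<subseteq> v_closure F A T" for S T
      using that v_closure_subset v_closure_subset_A by (meson order_trans)
  qed (use I t_ideal_iff subset_v_closure v_closure_subset_A in auto)
  \<comment> \<open>A t-ideal that strictly contains \<open>M\<close> contains some \<open>x\<close>
    outside \<open>M\<close> along with the finite set \<open>T\<close> belonging to
    \<open>x\<close>, hence \<open>\<one>\<close>.\<close>
  have eq: "N = M" if N: "t_ideal F A N" "\<one> \<notin> N" "M \<subseteq> N" for N
  proof (rule ccontr)
    assume "N \<noteq> M"
    then obtain x where x: "x \<in> N" "x \<notin> M" using N by blast
    then have "x \<in> A - M" using N by (auto simp: t_ideal_iff)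
    from bspec[OF max this] obtain T where T: "finite T" "T \<subseteq> M" "\<one> \<in> v_closure F A (insert x T)"
      by blast
    then have "v_closure F A (insert x T) \<subseteq> N"
      using N x T by (intro t_ideal_v_closure) auto
    then show False using T N by auto
  qed
  have tM: "t_ideal F A M" using M by (simp add: t_ideal_iff)
  have "M \<in> t_Max F A"
    unfolding t_Max_def mem_Collect_eq
  proof (intro conjI allI impI)
    show "M \<noteq> A" using t_ideal_proper_iff[OF tM] M by simp
    show "N = M" if "t_ideal F A N \<and> N \<noteq> A \<and> M \<subseteq> N" for N
      by (rule eq) (use that t_ideal_proper_iff[of N] in simp_all)
  qed (rule tM)
  from M(1) this max show ?thesis by (rule that)
qed

lemma t_MaxD:
  assumes "M \<in> t_Max F A"
  shows "t_ideal F A M" "\<one> \<notin> M" "M \<subseteq> A" "\<zero> \<in> M" "ideal M R"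
proof -
  show t: "t_ideal F A M" using assms by (simp add: t_Max_def)
  show "\<one> \<notin> M" using assms t_ideal_proper_iff[OF t] by (simp add: t_Max_def)
  show i: "ideal M R" by (rule t_ideal_ideal[OF t])
  show "M \<subseteq> A" "\<zero> \<in> M" using idealD[OF i] by simp_all
qed

lemma t_Max_eq: "M \<in> t_Max F A \<Longrightarrow> N \<in> t_Max F A \<Longrightarrow> M \<subseteq> N \<Longrightarrow> M = N"
  by (auto simp: t_Max_def)

lemma t_Max_prime:
  assumes M: "M \<in> t_Max F A"
  shows "primeideal M R"
  unfolding prime_iff
proof (intro conjI ballI impI)
  show "ideal M R" "M \<noteq> A" using t_MaxD[OF M] A_closed by auto
next
  fix x y assume xy: "x \<in> A" "y \<in> A" "x \<otimes> y \<in> M"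
  show "x \<in> M \<or> y \<in> M"
  proof (rule ccontr)
    assume n: "\<not> ?thesis"
    \<comment> \<open>The lemma is applied to \<open>M\<close> itself. Since the resulting
      \<open>N\<close> equals \<open>M\<close>, the finitary form of maximality holds for
      \<open>M\<close>.\<close>
    obtain N where N: "M \<subseteq> N" "N \<in> t_Max F A"
      and max: "\<forall>x\<in>A - N. \<exists>T. finite T \<and> T \<subseteq> N \<and> \<one> \<in> v_closure F A (insert x T)"
      by (rule t_ideal_maximal[OF t_MaxD(1,2)[OF M]])
    have "N = M" using t_Max_eq[OF M N(2,1)] by (rule sym)
    note ex = max[unfolded this]
    obtain T where T: "finite T" "T \<subseteq> M" "\<one> \<in> v_closure F A (insert x T)" using ex n xy by blast
    obtain U where U: "finite U" "U \<subseteq> M" "\<one> \<in> v_closure F A (insert y U)" using ex n xy by blast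
    have "\<one> \<in> v_closure F A (insert (x \<otimes> y) (T \<union> U))"
    proof (rule one_in_v_closure_mult)
      show "\<one> \<in> v_closure F A (insert x (T \<union> U))" "\<one> \<in> v_closure F A (insert y (T \<union> U))"
        using T U v_closure_mono[of "insert x T" "insert x (T \<union> U)"]
          v_closure_mono[of "insert y U" "insert y (T \<union> U)"] by auto
    qed (use T U xy t_MaxD(3)[OF M] in auto)
    moreover have "v_closure F A (insert (x \<otimes> y) (T \<union> U)) \<subseteq> M"
      using t_MaxD(1)[OF M] T U xy by (intro t_ideal_v_closure) auto
    ultimately show False using t_MaxD(2)[OF M] by auto
  qed
qed

section \<open>The Zariski and inverse topologies on the spectrum\<close>

lemma SpecD:
  assumes "Q \<in> Spec R"
  shows "ideal Q R" "Q \<subseteq> A" "Q \<noteq> A"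
    and "x \<in> A \<Longrightarrow> y \<in> A \<Longrightarrow> x \<otimes> y \<in> Q \<longleftrightarrow> x \<in> Q \<or> y \<in> Q"
proof -
  have p: "ideal Q R \<and> Q \<noteq> A \<and> (\<forall>a\<in>A. \<forall>b\<in>A. a \<otimes> b \<in> Q \<longrightarrow> a \<in> Q \<or> b \<in> Q)"
    using assms unfolding Spec_def mem_Collect_eq prime_iff .
  then show i: "ideal Q R" and "Q \<noteq> A" by simp_all
  show "Q \<subseteq> A" by (rule idealD(1)[OF i])
  show "x \<otimes> y \<in> Q \<longleftrightarrow> x \<in> Q \<or> y \<in> Q" if "x \<in> A" "y \<in> A"
    using p that idealD(4)[OF i, of x y] idealD(5)[OF i, of y x] by auto
qed

text \<open>The principal open set usually written \<open>D(a)\<close>.\<close>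

definition basic_open :: "'a \<Rightarrow> 'a set set" where
  "basic_open a = {Q \<in> Spec R. a \<notin> Q}"

lemma openin_basic_open: "a \<in> A \<Longrightarrow> openin (zariski_topology R) (basic_open a)"
  unfolding zariski_topology_def by (rule topology_generated_by_Basis) (simp add: basic_open_def)

text \<open>The generating sets form a basis and not only a subbasis, because \<open>D(b)\<close>
  and \<open>D(c)\<close> intersect in \<open>D(b \<otimes> c)\<close> by primeness.\<close>

lemma zariski_topology_basis:
  assumes "openin (zariski_topology R) U" "Q \<in> U"
  shows "\<exists>b\<in>A. Q \<in> basic_open b \<and> basic_open b \<subseteq> U"
proof -
  have "generate_topology_on ((\<lambda>a. {P \<in> Spec R. a \<notin> P}) ` carrier R) U"
    using assms(1) unfolding zariski_topology_def by (rule openin_topology_generated_by)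
  then show ?thesis using assms(2)
  proof (induction arbitrary: Q rule: generate_topology_on.induct)
    case (Int U W)
    obtain b where b: "b \<in> A" "Q \<in> basic_open b" "basic_open b \<subseteq> U" using Int by blast
    obtain c where c: "c \<in> A" "Q \<in> basic_open c" "basic_open c \<subseteq> W" using Int by blast
    have "basic_open (b \<otimes> c) = basic_open b \<inter> basic_open c"
      using b(1) c(1) SpecD(4) by (auto simp: basic_open_def)
    then show ?case using b c by (intro bexI[of _ "b \<otimes> c"]) auto
  next
    case (UN K)
    then obtain k where k: "k \<in> K" "Q \<in> k" by blast
    then show ?case using UN.IH[OF k] by blast
  next
    case (Basis U)
    then obtain b where "b \<in> A" "U = basic_open b" by (auto simp: basic_open_def)
    then show ?case using Basis by blast
  qed simp
qed

text \<open>The algebraic form of the quasicompactness of \<open>D(a)\<close>. If no finite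
  \<open>T\<close> works, then \<open>a\<close> lies outside the closed set \<open>I\<close>
  generated by \<open>C\<close>, and a closed set that contains \<open>I\<close> and is maximal
  without \<open>a\<close> is a prime ideal containing \<open>C\<close>.\<close>

lemma prime_contains_finite:
  assumes C: "C \<subseteq> A" "a \<in> A" and all: "\<And>Q. Q \<in> Spec R \<Longrightarrow> C \<subseteq> Q \<Longrightarrow> a \<in> Q"
  shows "\<exists>T. finite T \<and> T \<subseteq> C \<and> (\<forall>Q\<in>Spec R. T \<subseteq> Q \<longrightarrow> a \<in> Q)"
proof (rule ccontr)
  assume no: "\<not> ?thesis"
  define c where "c T = {x \<in> A. \<forall>Q\<in>Spec R. T \<subseteq> Q \<longrightarrow> x \<in> Q}" for T
  define I where "I = (\<Union>T\<in>{T. finite T \<and> T \<subseteq> C}. c T)"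
  have idem: "c S \<subseteq> c T" if "S \<subseteq> c T" for S T
    using that unfolding c_def by blast
  have ext: "T \<subseteq> c T" if "T \<subseteq> A" for T using that unfolding c_def by blast
  have c_mono: "c T \<subseteq> c U" if "T \<subseteq> U" for T U using that unfolding c_def by blast
  have "c S \<subseteq> I" if S: "finite S" "S \<subseteq> I" for S
  proof -
    obtain T where "finite T" "T \<subseteq> C" "S \<subseteq> c T"
      using S c_mono unfolding I_def by (rule finite_subset_directed_Union[where g = c])
    then show ?thesis using idem[of S T] unfolding I_def by blast
  qed
  then have closed: "finitary_closed c I" by (simp add: finitary_closed_def)
  have IA: "I \<subseteq> A" by (auto simp: I_def c_def)
  have aI: "a \<notin> I" using no by (auto simp: I_def c_def)
  have cA: "c T \<subseteq> A" for T by (auto simp: c_def)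
  obtain M where M: "I \<subseteq> M" "M \<subseteq> A" "finitary_closed c M" "a \<notin> M"
    and max: "\<forall>x\<in>A - M. \<exists>T. finite T \<and> T \<subseteq> M \<and> a \<in> c (insert x T)"
    by (rule maximal_finitary_closed[of A c I a, OF ext cA idem IA closed aI])
  have cM: "x \<in> M" if "finite T" "T \<subseteq> M" "x \<in> c T" for x T
    using that M(3) unfolding finitary_closed_def by blast
  have "ideal M R"
    unfolding ideal_iff
  proof (intro conjI ballI)
    show "M \<subseteq> A" by (rule M)
    show "\<zero> \<in> M" using cM[of "{}"] idealD(2)[OF SpecD(1)] by (simp add: c_def)
    show "x \<oplus> y \<in> M" if "x \<in> M" "y \<in> M" for x y
      using cM[of "{x, y}"] that M(2) idealD(3)[OF SpecD(1), of _ x y] by (auto simp: c_def)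
    show "r \<otimes> x \<in> M" if "r \<in> A" "x \<in> M" for r x
      using cM[of "{x}"] that M(2) idealD(4)[OF SpecD(1), of _ r x] by (auto simp: c_def)
  qed
  moreover have "x \<in> M \<or> y \<in> M" if xy: "x \<in> A" "y \<in> A" "x \<otimes> y \<in> M" for x y
  proof (rule ccontr)
    assume "\<not> ?thesis"
    then have "x \<in> A - M" "y \<in> A - M" using xy by auto
    obtain T where T: "finite T" "T \<subseteq> M" "a \<in> c (insert x T)" using bspec[OF max \<open>x \<in> A - M\<close>] by blast
    obtain U where U: "finite U" "U \<subseteq> M" "a \<in> c (insert y U)" using bspec[OF max \<open>y \<in> A - M\<close>] by blast
    \<comment> \<open>A prime that contains \<open>x \<otimes> y\<close> contains \<open>x\<close>
      or \<open>y\<close>, so with \<open>T\<close> and \<open>U\<close> it contains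
      \<open>a\<close> in both cases.\<close>
    have "a \<in> c (insert (x \<otimes> y) (T \<union> U))"
      using T U SpecD(4)[OF _ xy(1,2)] by (auto simp: c_def)
    then have "a \<in> M" using cM[of "insert (x \<otimes> y) (T \<union> U)"] T U xy by simp
    then show False using M by simp
  qed
  moreover have "M \<noteq> A" using M C by auto
  ultimately have "M \<in> Spec R" by (simp add: Spec_def prime_iff)
  moreover have "C \<subseteq> M"
  proof
    fix x assume x: "x \<in> C"
    then have "x \<in> c {x}" using ext[of "{x}"] C by auto
    then have "x \<in> I" using x by (auto simp: I_def)
    then show "x \<in> M" using M by auto
  qed
  ultimately show False using all M by auto
qed

text \<open>A prime in \<open>D(a)\<close> lies in some \<open>D(b)\<close> inside a member of the
  cover, so every prime containing the set \<open>C\<close> of all such \<open>b\<close> contains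
  \<open>a\<close>. Finitely many \<open>b\<close> suffice by
  \<open>prime_contains_finite\<close>.\<close>

lemma compactin_basic_open:
  assumes a: "a \<in> A"
  shows "compactin (zariski_topology R) (basic_open a)"
  unfolding compactin_def
proof (intro conjI allI impI)
  show "basic_open a \<subseteq> topspace (zariski_topology R)"
    by (rule openin_subset[OF openin_basic_open[OF a]])
next
  fix \<U> assume U: "(\<forall>U\<in>\<U>. openin (zariski_topology R) U) \<and> basic_open a \<subseteq> \<Union>\<U>"
  define C where "C = {b \<in> A. \<exists>U\<in>\<U>. basic_open b \<subseteq> U}"
  have "a \<in> Q" if Q: "Q \<in> Spec R" "C \<subseteq> Q" for Q
  proof (rule ccontr)
    assume "a \<notin> Q"
    then obtain W where W: "W \<in> \<U>" "Q \<in> W" using U Q by (auto simp: basic_open_def)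
    then have "openin (zariski_topology R) W" using U by simp
    then obtain b where b: "b \<in> A" "Q \<in> basic_open b" "basic_open b \<subseteq> W"
      using zariski_topology_basis W(2) by blast
    then have "b \<in> C" using W by (auto simp: C_def)
    then show False using b(2) Q by (auto simp: basic_open_def)
  qed
  then obtain T where T: "finite T" "T \<subseteq> C" "\<forall>Q\<in>Spec R. T \<subseteq> Q \<longrightarrow> a \<in> Q"
    using prime_contains_finite[of C a] a by (auto simp: C_def)
  have "\<forall>b\<in>T. \<exists>U\<in>\<U>. basic_open b \<subseteq> U" using T(2) by (auto simp: C_def)
  then obtain f where f: "\<forall>b\<in>T. f b \<in> \<U> \<and> basic_open b \<subseteq> f b" by metis
  have "basic_open a \<subseteq> \<Union>(f ` T)"
  proof
    fix Q assume Q: "Q \<in> basic_open a"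
    then obtain b where "b \<in> T" "b \<notin> Q" using T(3) by (auto simp: basic_open_def)
    then have "Q \<in> f b" using f Q by (auto simp: basic_open_def)
    then show "Q \<in> \<Union>(f ` T)" using \<open>b \<in> T\<close> by blast
  qed
  then show "\<exists>\<F>. finite \<F> \<and> \<F> \<subseteq> \<U> \<and> basic_open a \<subseteq> \<Union>\<F>"
    using T(1) f by (intro exI[of _ "f ` T"]) auto
qed

lemma openin_inverse_topology_containing:
  assumes "finite S" "S \<subseteq> A"
  shows "openin (inverse_topology R) {Q \<in> Spec R. S \<subseteq> Q}"
  using assms
proof (induction S rule: finite_induct)
  case empty
  \<comment> \<open>The whole spectrum is open as the complement of the empty set, which is
    quasicompact and open.\<close>
  have "openin (inverse_topology R) (Spec R - {})"
    unfolding inverse_topology_def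
    by (rule topology_generated_by_Basis) (use compactin_empty openin_empty in blast)
  then show ?case by simp
next
  case (insert b S)
  have "openin (inverse_topology R) (Spec R - basic_open b)"
    unfolding inverse_topology_def
    by (rule topology_generated_by_Basis) (use insert openin_basic_open compactin_basic_open in blast)
  moreover have "{Q \<in> Spec R. insert b S \<subseteq> Q} = (Spec R - basic_open b) \<inter> {Q \<in> Spec R. S \<subseteq> Q}"
    by (auto simp: basic_open_def)
  ultimately show ?case using insert by (simp add: openin_Int)
qed

text \<open>A quasicompact open set is a finite union of sets \<open>D(b)\<close>, so its complement
  consists of the primes that contain a finite set \<open>S\<close>.\<close>

lemma inverse_topology_basis:
  assumes "openin (inverse_topology R) U" "P \<in> U"
  shows "P \<in> Spec R \<and> (\<exists>S. finite S \<and> S \<subseteq> P \<and> (\<forall>Q\<in>Spec R. S \<subseteq> Q \<longrightarrow> Q \<in> U))"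
proof -
  have "generate_topology_on {Spec R - U | U. openin (zariski_topology R) U \<and> compactin (zariski_topology R) U} U"
    using assms(1) unfolding inverse_topology_def by (rule openin_topology_generated_by)
  then show ?thesis using assms(2)
  proof (induction rule: generate_topology_on.induct)
    case (Int U W)
    obtain S where S: "finite S" "S \<subseteq> P" "\<forall>Q\<in>Spec R. S \<subseteq> Q \<longrightarrow> Q \<in> U" using Int by blast
    obtain T where T: "finite T" "T \<subseteq> P" "\<forall>Q\<in>Spec R. T \<subseteq> Q \<longrightarrow> Q \<in> W" using Int by blast
    have "\<forall>Q\<in>Spec R. S \<union> T \<subseteq> Q \<longrightarrow> Q \<in> U \<inter> W" using S T by simp
    moreover have "finite (S \<union> T)" "S \<union> T \<subseteq> P" using S T by simp_all
    moreover have "P \<in> Spec R" using Int by blast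
    ultimately show ?case by blast
  next
    case (UN K)
    from UN.prems obtain k where k: "k \<in> K" "P \<in> k" by blast
    have P: "P \<in> Spec R" using UN.IH[OF k] by blast
    obtain S where S: "finite S" "S \<subseteq> P" "\<forall>Q\<in>Spec R. S \<subseteq> Q \<longrightarrow> Q \<in> k"
      using UN.IH[OF k] by blast
    have "\<forall>Q\<in>Spec R. S \<subseteq> Q \<longrightarrow> Q \<in> \<Union>K" using S(3) k(1) by auto
    with P S(1,2) show ?case by blast
  next
    case (Basis s)
    then obtain C where C: "s = Spec R - C" "openin (zariski_topology R) C" "compactin (zariski_topology R) C"
      by blast
    define \<B> where "\<B> = basic_open ` {b \<in> A. basic_open b \<subseteq> C}"
    have cover: "C \<subseteq> \<Union>\<B>" using zariski_topology_basis[OF C(2)] unfolding \<B>_def by blast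
    have "openin (zariski_topology R) B" if "B \<in> \<B>" for B
      using that openin_basic_open unfolding \<B>_def by blast
    from compactinD[OF C(3) this cover] obtain \<F> where F: "finite \<F>" "\<F> \<subseteq> \<B>" "C \<subseteq> \<Union>\<F>"
      by blast
    from finite_subset_image[OF F(1) F(2)[unfolded \<B>_def]]
    obtain S where S: "finite S" "S \<subseteq> {b \<in> A. basic_open b \<subseteq> C}" "\<F> = basic_open ` S" by blast
    have P: "P \<in> Spec R" "P \<notin> C" using Basis C by auto
    then have "S \<subseteq> P" using S(2) by (auto simp: basic_open_def)
    moreover have "Q \<in> s" if "Q \<in> Spec R" "S \<subseteq> Q" for Q
    proof -
      have "Q \<notin> \<Union>\<F>" using that S(3) by (auto simp: basic_open_def)
      then show ?thesis using that F(3) C(1) by auto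
    qed
    ultimately show ?case using P S(1) by blast
  qed simp
qed

text \<open>The primes containing a finite set form a basis of the inverse topology, and
  \<open>t_Max_prime\<close> places the t-maximal ideals in the spectrum.\<close>

lemma isolated_in_t_Max_iff:
  assumes P: "P \<in> t_Max F A"
  shows "isolated_in_t_Max F A P \<longleftrightarrow>
    (\<exists>S. finite S \<and> S \<subseteq> P \<and> (\<forall>M\<in>t_Max F A. S \<subseteq> M \<longrightarrow> M = P))"
proof
  assume "isolated_in_t_Max F A P"
  then obtain U where U: "openin (inverse_topology R) U" "{P} = U \<inter> t_Max F A"
    unfolding isolated_in_t_Max_def openin_subtopology by blast
  have "P \<in> U" using U(2) by blast
  from inverse_topology_basis[OF U(1) this]
  obtain S where S: "finite S" "S \<subseteq> P" "\<forall>Q\<in>Spec R. S \<subseteq> Q \<longrightarrow> Q \<in> U" by blast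
  have "M = P" if "M \<in> t_Max F A" "S \<subseteq> M" for M
  proof -
    have "M \<in> Spec R" using t_Max_prime[OF that(1)] by (simp add: Spec_def)
    then have "M \<in> U \<inter> t_Max F A" using S that by simp
    then show ?thesis using U(2) by blast
  qed
  then show "\<exists>S. finite S \<and> S \<subseteq> P \<and> (\<forall>M\<in>t_Max F A. S \<subseteq> M \<longrightarrow> M = P)" using S by blast
next
  assume "\<exists>S. finite S \<and> S \<subseteq> P \<and> (\<forall>M\<in>t_Max F A. S \<subseteq> M \<longrightarrow> M = P)"
  then obtain S where S: "finite S" "S \<subseteq> P" "\<forall>M\<in>t_Max F A. S \<subseteq> M \<longrightarrow> M = P" by blast
  have "S \<subseteq> A" using S t_MaxD(3)[OF P] by simp
  have "P \<in> Spec R" using t_Max_prime[OF P] by (simp add: Spec_def)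
  then have "{P} \<subseteq> {Q \<in> Spec R. S \<subseteq> Q} \<inter> t_Max F A" using S(2) P by simp
  moreover have "{Q \<in> Spec R. S \<subseteq> Q} \<inter> t_Max F A \<subseteq> {P}" using S(3) by blast
  ultimately have "{P} = {Q \<in> Spec R. S \<subseteq> Q} \<inter> t_Max F A" by (rule equalityI)
  with openin_inverse_topology_containing[OF S(1) \<open>S \<subseteq> A\<close>]
  show "isolated_in_t_Max F A P"
    unfolding isolated_in_t_Max_def openin_subtopology
    by (intro exI[of _ "{Q \<in> Spec R. S \<subseteq> Q}"] conjI)
qed

end

section \<open>Localizations of a PvMD at t-maximal ideals\<close>

locale proper_PvMD = fraction_field +
  assumes PvMD: "PvMD F A" and proper: "carrier F \<noteq> A"
begin

text \<open>Since \<open>\<one>\<close> lies in the t-closure of the product of the ideal of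
  \<open>T\<close> with its colon, it already lies in the v-closure of finitely many elements of
  that product, and these involve only finitely many elements of the colon. One \<open>K\<close>
  serves all \<open>M\<close>, which later yields a finite generating set.\<close>

lemma t_invertible_finite:
  assumes T: "finite T" "T \<subseteq> A" "\<not> T \<subseteq> {\<zero>}"
  shows "\<exists>K. finite K \<and> K \<subseteq> colon F A T \<and> (\<forall>M\<in>t_Max F A. \<exists>t\<in>T. \<exists>k\<in>K. t \<otimes> k \<notin> M)"
proof -
  define C where "C = colon F A T"
  define I where "I = Idl\<^bsub>R\<^esub> T"
  \<comment> \<open>\<open>g K\<close> is the ideal generated by the products of elements of \<open>T\<close> and \<open>K\<close>.\<close>
  define g where "g K = \<Inter>{M. ideal M R \<and> (\<forall>t\<in>T. \<forall>k\<in>K. t \<otimes> k \<in> M)}" for K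
  have I: "ideal I R" "T \<subseteq> I" using T Idl_ideal subset_Idl by (auto simp: I_def)
  have CF: "C \<subseteq> carrier F" and CT: "\<And>t k. t \<in> T \<Longrightarrow> k \<in> C \<Longrightarrow> t \<otimes> k \<in> A"
    using T by (auto simp: C_def colon_def m_comm subset_iff)
  have gA: "g K \<subseteq> A" if "K \<subseteq> C" for K
  proof -
    have "ideal A R" by (auto simp: ideal_iff)
    moreover have "\<forall>t\<in>T. \<forall>k\<in>K. t \<otimes> k \<in> A" using that CT by blast
    ultimately show ?thesis unfolding g_def by (intro Inter_lower) simp
  qed
  have g_mono: "g K \<subseteq> g L" if "K \<subseteq> L" for K L
    unfolding g_def by (rule Inter_anti_mono) (use that in blast)
  have g_ideal: "x \<oplus> y \<in> g K" if "x \<in> g K" "y \<in> g K" for x y K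
    using that idealD(3)[of _ x y] unfolding g_def by simp
  have prod: "i \<otimes> k \<in> g {k}" if "i \<in> I" "k \<in> C" for i k
  proof -
    have "i \<otimes> k \<in> M" if M: "ideal M R" "\<forall>t\<in>T. t \<otimes> k \<in> M" for M
    proof -
      have "ideal {y \<in> A. y \<otimes> k \<in> M} R"
        using idealD[OF M(1)] \<open>k \<in> C\<close> CF by (auto simp: ideal_iff l_distr m_assoc subset_iff)
      then have "I \<subseteq> {y \<in> A. y \<otimes> k \<in> M}"
        unfolding I_def by (subst Idl_subset_iff) (use T M in auto)
      then show ?thesis using \<open>i \<in> I\<close> by auto
    qed
    then show ?thesis by (auto simp: g_def)
  qed
  define Z where "Z = ideal_prod F I C"
  \<comment> \<open>Induction along the generation of the product: each of its elements uses only
    finitely many elements of \<open>C\<close>.\<close>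
  have Z: "Z \<subseteq> (\<Union>K\<in>{K. finite K \<and> K \<subseteq> C}. g K)"
  proof
    fix z assume "z \<in> Z"
    then have "\<exists>K. finite K \<and> K \<subseteq> C \<and> z \<in> g K"
      unfolding Z_def
    proof (induction rule: ideal_prod.induct)
      case (prod i j)
      then show ?case using \<open>\<And>k i. i \<in> I \<Longrightarrow> k \<in> C \<Longrightarrow> i \<otimes> k \<in> g {k}\<close> by (intro exI[of _ "{j}"]) auto
    next
      case (sum x y)
      then obtain K L where K: "finite K" "K \<subseteq> C" "x \<in> g K" and L: "finite L" "L \<subseteq> C" "y \<in> g L"
        by blast
      have "x \<oplus> y \<in> g (K \<union> L)"
        using K L g_mono[of K "K \<union> L"] g_mono[of L "K \<union> L"] by (intro g_ideal) auto
      then show ?case using K L by (intro exI[of _ "K \<union> L"]) auto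
    qed
    then show "z \<in> (\<Union>K\<in>{K. finite K \<and> K \<subseteq> C}. g K)" by blast
  qed
  then have "Z \<subseteq> A" using gA by blast
  have "t_closure F A Z = A"
  proof -
    have "fg_ideal R I" using T by (auto simp: I_def fg_ideal_def)
    moreover have "I \<noteq> {\<zero>}" using T I by auto
    moreover have "colon F A I = C" using T by (simp add: I_def C_def colon_Idl)
    ultimately show ?thesis using PvMD by (auto simp: PvMD_def Z_def)
  qed
  then have "\<one> \<in> (\<Union>T\<in>{T. finite T \<and> T \<subseteq> Z}. v_closure F A T)"
    using t_closure_subset_Union[OF \<open>Z \<subseteq> A\<close>] A_closed by auto
  then obtain S where S: "finite S" "S \<subseteq> Z" "\<one> \<in> v_closure F A S" by auto
  obtain K where K: "finite K" "K \<subseteq> C" "S \<subseteq> g K"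
    using finite_subset_directed_Union[where S = S and M = C and g = g] S Z g_mono by (metis order_trans)
  have "\<exists>t\<in>T. \<exists>k\<in>K. t \<otimes> k \<notin> M" if M: "M \<in> t_Max F A" for M
  proof (rule ccontr)
    assume "\<not> ?thesis"
    then have "g K \<subseteq> M" using t_MaxD(5)[OF M] by (auto simp: g_def)
    then have "v_closure F A S \<subseteq> M"
      using t_MaxD(1)[OF M] K S by (intro t_ideal_v_closure) auto
    then show False using S t_MaxD(2)[OF M] by auto
  qed
  then show ?thesis using K unfolding C_def by (intro exI[of _ K]) simp
qed

text \<open>At \<open>M\<close> the element \<open>t\<close> alone generates the ideal of
  \<open>T\<close>: from \<open>u \<otimes> (t \<otimes> k) = (u \<otimes> k) \<otimes> t\<close>,
  where \<open>t \<otimes> k\<close> is a unit of \<open>A\<^sub>M\<close>.\<close>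

lemma t_invertible_at:
  assumes T: "finite T" "T \<subseteq> A" "\<not> T \<subseteq> {\<zero>}" and M: "M \<in> t_Max F A"
  obtains t k where "t \<in> T" "k \<in> carrier F" "t \<otimes> k \<notin> M" "\<forall>u\<in>T. u \<otimes> k \<in> A"
proof -
  obtain K where K: "K \<subseteq> colon F A T" "\<forall>M\<in>t_Max F A. \<exists>t\<in>T. \<exists>k\<in>K. t \<otimes> k \<notin> M"
    using t_invertible_finite[OF T] by blast
  from bspec[OF K(2) M] obtain t k where tk: "t \<in> T" "k \<in> K" "t \<otimes> k \<notin> M" by blast
  have k: "k \<in> carrier F" using tk K(1) by (auto simp: colon_def)
  have "\<forall>u\<in>T. u \<otimes> k \<in> A"
  proof
    fix u assume that: "u \<in> T"
    have "k \<otimes> u \<in> A" using K(1) tk that by (auto simp: colon_def)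
    then show "u \<otimes> k \<in> A" using m_comm[of k u] that k T(2) by auto
  qed
  with tk(1) k tk(3) show ?thesis by (rule that)
qed

section \<open>The rings \<open>A\<^sub>M\<close> as valuation rings with intersection
  \<open>A\<close>\<close>

lemma mem_localization:
  "M \<in> t_Max F A \<Longrightarrow> x \<in> localization F A M \<longleftrightarrow> x \<in> carrier F \<and> (\<exists>s\<in>A - M. s \<otimes> x \<in> A)"
  by (simp add: mem_localization_iff t_MaxD)

lemma localizationI:
  "M \<in> t_Max F A \<Longrightarrow> x \<in> carrier F \<Longrightarrow> s \<in> A - M \<Longrightarrow> s \<otimes> x \<in> A \<Longrightarrow> x \<in> localization F A M"
  using mem_localization by blast

lemma localizationE:
  assumes "x \<in> localization F A M" "M \<in> t_Max F A"
  obtains s where "x \<in> carrier F" "s \<in> A" "s \<notin> M" "s \<otimes> x \<in> A"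
  using assms mem_localization by blast

lemma t_Max_mult:
  assumes M: "M \<in> t_Max F A" and xy: "x \<in> A" "y \<in> A"
  shows "x \<otimes> y \<in> M \<longleftrightarrow> x \<in> M \<or> y \<in> M"
  using t_Max_prime[OF M] xy idealD(4)[OF t_MaxD(5)[OF M], of x y]
    idealD(5)[OF t_MaxD(5)[OF M], of y x] by (auto simp: prime_iff)

lemma localization_valuation:
  assumes M: "M \<in> t_Max F A"
  shows "valuation_overring F A (localization F A M)"
proof -
  note I = localizationI[OF M] and E = localizationE[OF _ M] and mult = t_Max_mult[OF M]
  have sub: "A \<subseteq> localization F A M"
    using t_MaxD(2)[OF M] by (auto intro!: I[of _ \<one>])
  have "subring (localization F A M) F"
  proof (rule subringI)
    show "localization F A M \<subseteq> carrier F" by (auto elim: E)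
    show "\<one> \<in> localization F A M" using sub by auto
  next
    fix x assume "x \<in> localization F A M"
    then obtain s where s: "x \<in> carrier F" "s \<in> A" "s \<notin> M" "s \<otimes> x \<in> A" by (rule E)
    then show "\<ominus> x \<in> localization F A M" by (intro I[of _ s]) (auto simp: r_minus)
  next
    fix x y assume x: "x \<in> localization F A M" and y: "y \<in> localization F A M"
    obtain s where s: "x \<in> carrier F" "s \<in> A" "s \<notin> M" "s \<otimes> x \<in> A" using x by (rule E)
    obtain r where r: "y \<in> carrier F" "r \<in> A" "r \<notin> M" "r \<otimes> y \<in> A" using y by (rule E)
    have sr: "s \<otimes> r \<in> A - M" using s r mult by auto
    have "(s \<otimes> r) \<otimes> (x \<otimes> y) = (s \<otimes> x) \<otimes> (r \<otimes> y)" using s r by (simp add: m_ac)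
    then show "x \<otimes> y \<in> localization F A M" using s r by (intro I[OF _ sr]) auto
    have "(s \<otimes> r) \<otimes> (x \<oplus> y) = r \<otimes> (s \<otimes> x) \<oplus> s \<otimes> (r \<otimes> y)" using s r by (simp add: r_distr m_ac)
    then show "x \<oplus> y \<in> localization F A M" using s r by (intro I[OF _ sr]) auto
  qed
  moreover have "x \<in> localization F A M \<or> inv x \<in> localization F A M"
    if x: "x \<in> carrier F - {\<zero>}" for x
  proof -
    obtain a b where ab: "a \<in> A" "b \<in> A" "b \<noteq> \<zero>" "x = a \<otimes> inv b" using fraction x by blast
    then have bx: "b \<otimes> x = a" "a = x \<otimes> b" by (simp_all add: m_lcomm m_assoc)
    have xF: "x \<in> carrier F" "x \<noteq> \<zero>" using x by auto
    have T: "finite {a, b}" "{a, b} \<subseteq> A" "\<not> {a, b} \<subseteq> {\<zero>}" using ab by simp_all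
    \<comment> \<open>If \<open>a \<otimes> k\<close> lies outside \<open>M\<close>, it is a
      denominator for \<open>inv x\<close>; if \<open>b \<otimes> k\<close> does, it is a
      denominator for \<open>x\<close>.\<close>
    obtain t k where tk: "t \<in> {a, b}" "k \<in> carrier F" "t \<otimes> k \<notin> M"
      and kA: "\<forall>u\<in>{a, b}. u \<otimes> k \<in> A"
      by (rule t_invertible_at[OF T M])
    note kF = \<open>k \<in> carrier F\<close>
    consider "a \<otimes> k \<notin> M" | "b \<otimes> k \<notin> M" using tk by auto
    then show ?thesis
    proof cases
      case 1
      have "(a \<otimes> k) \<otimes> inv x = x \<otimes> (inv x \<otimes> (b \<otimes> k))"
        unfolding bx(2) using ab(2) xF kF by (simp del: inv_r mult_inv_cancel add: m_ac)
      then have "(a \<otimes> k) \<otimes> inv x = b \<otimes> k" using ab(2) xF kF by simp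
      then have "inv x \<in> localization F A M" using 1 kA xF by (intro I[of _ "a \<otimes> k"]) auto
      then show ?thesis ..
    next
      case 2
      have "(b \<otimes> k) \<otimes> x = a \<otimes> k"
        unfolding bx(1)[symmetric] using ab(2) xF kF by (simp add: m_ac)
      then have "x \<in> localization F A M" using 2 kA xF by (intro I[of _ "b \<otimes> k"]) auto
      then show ?thesis ..
    qed
  qed
  ultimately show ?thesis using sub by (simp add: valuation_overring_def)
qed

text \<open>The denominators of \<open>x\<close> form a t-ideal \<open>D\<close>, because
  \<open>x\<close> lies in the colon of every subset of \<open>D\<close>. If \<open>D\<close> is
  proper, some t-maximal \<open>M\<close> contains it, and then no denominator is left to place
  \<open>x\<close> in \<open>A\<^sub>M\<close>.\<close>

lemma in_A_if_in_localizations: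
  assumes x: "x \<in> carrier F" "\<And>M. M \<in> t_Max F A \<Longrightarrow> x \<in> localization F A M"
  shows "x \<in> A"
proof (rule ccontr)
  assume nx: "x \<notin> A"
  define D where "D = {s \<in> A. x \<otimes> s \<in> A}"
  have "v_closure F A T \<subseteq> D" if T: "T \<subseteq> D" for T
  proof -
    have "x \<in> colon F A T" using T x by (auto simp: D_def colon_def)
    moreover have "v_closure F A T \<subseteq> A" using T by (intro v_closure_subset_A) (auto simp: D_def)
    ultimately show ?thesis
      using x by (auto simp: v_closure_def D_def) (auto simp: colon_def m_comm)
  qed
  then have "t_ideal F A D" by (auto simp: t_ideal_iff finitary_closed_def D_def)
  moreover have "\<one> \<notin> D" using nx x by (auto simp: D_def)
  ultimately obtain M where M: "D \<subseteq> M" "M \<in> t_Max F A" by (rule t_ideal_maximal)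
  then obtain s where "s \<in> A" "s \<notin> M" "s \<otimes> x \<in> A" using x by (blast elim: localizationE)
  then show False using M x m_comm[of s x] by (auto simp: D_def)
qed

text \<open>For \<open>x\<close> in \<open>M\<close> but not in \<open>N\<close> and
  \<open>y\<close> in \<open>N\<close> but not in \<open>M\<close>, the quotient \<open>y/x\<close>
  is not in \<open>A\<^sub>M\<close> and \<open>x/y\<close> is not in \<open>A\<^sub>N\<close>,
  while \<open>V\<close> contains one of them.\<close>

lemma t_Max_eq_if_valuation_subset:
  assumes V: "valuation_overring F A V"
    and M: "M \<in> t_Max F A" "V \<subseteq> localization F A M"
    and N: "N \<in> t_Max F A" "V \<subseteq> localization F A N"
  shows "M = N"
proof (rule ccontr)
  assume "M \<noteq> N"
  then obtain x y where x: "x \<in> M" "x \<notin> N" and y: "y \<in> N" "y \<notin> M"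
    using t_Max_eq[OF M(1) N(1)] t_Max_eq[OF N(1) M(1)] by blast
  have xyA: "x \<in> A" "y \<in> A" using x y t_MaxD(3) M N by blast+
  have xy0: "x \<noteq> \<zero>" "y \<noteq> \<zero>" using x y t_MaxD(4)[OF M(1)] t_MaxD(4)[OF N(1)] by auto
  have inv_xy: "inv (x \<otimes> inv y) = y \<otimes> inv x"
    using xyA xy0 by (intro inv_divide) auto
  have no: "a \<otimes> inv b \<notin> V"
    if M: "M \<in> t_Max F A" "V \<subseteq> localization F A M" and ab: "a \<in> A" "b \<in> M" "a \<notin> M" "b \<noteq> \<zero>" for a b M
  proof
    assume "a \<otimes> inv b \<in> V"
    then have "a \<otimes> inv b \<in> localization F A M" using M by auto
    then obtain s where s: "s \<in> A" "s \<notin> M" "s \<otimes> (a \<otimes> inv b) \<in> A"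
      by (rule localizationE[OF _ M(1)])
    have bA: "b \<in> A" using ab t_MaxD(3)[OF M(1)] by auto
    have "b \<otimes> (s \<otimes> (a \<otimes> inv b)) = s \<otimes> a \<otimes> (b \<otimes> inv b)"
      using s ab bA by (simp del: inv_r mult_inv_cancel add: m_ac)
    then have "s \<otimes> a = b \<otimes> (s \<otimes> (a \<otimes> inv b))" using s ab bA by simp
    then have "s \<otimes> a \<in> M" using s ab bA by (simp add: t_Max_mult[OF M(1)])
    then show False using s ab t_Max_mult[OF M(1)] by auto
  qed
  have "x \<otimes> inv y \<in> carrier F - {\<zero>}" using xyA xy0 by (simp add: integral_iff)
  then have "x \<otimes> inv y \<in> V \<or> y \<otimes> inv x \<in> V"
    using V unfolding inv_xy[symmetric] valuation_overring_def by blast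
  then show False using no[OF M, of y x] no[OF N, of x y] x y xyA xy0 by auto
qed

section \<open>The center of a valuation overring\<close>

text \<open>The nonunits of \<open>V\<close> form an ideal containing every proper ideal of
  \<open>V\<close>, so the definite description in \<open>center\<close> picks it out.\<close>

lemma center_eq:
  assumes V: "valuation_overring F A V"
  shows "center F A V = {x \<in> A. x = \<zero> \<or> inv x \<notin> V}"
proof -
  have sub: "subring V F" and AV: "A \<subseteq> V"
    and val: "\<And>x. x \<in> carrier F \<Longrightarrow> x \<noteq> \<zero> \<Longrightarrow> x \<in> V \<or> inv x \<in> V"
    using V by (auto simp: valuation_overring_def)
  note VF = subringE(1)[OF sub] and [simp] = subringE(2,3,6,7)[OF sub]
  have carr: "x \<in> V \<Longrightarrow> x \<in> carrier F" for x using VF by blast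
  define m where "m = {x \<in> V. x = \<zero> \<or> inv x \<notin> V}"
  have mult: "a \<otimes> x \<in> m" if "a \<in> V" "x \<in> m" for a x
  proof -
    have x: "x \<in> V" "x = \<zero> \<or> inv x \<notin> V" using that by (auto simp: m_def)
    have False if n: "a \<otimes> x \<noteq> \<zero>" "inv (a \<otimes> x) \<in> V"
    proof -
      have ax: "a \<noteq> \<zero>" "x \<noteq> \<zero>" using n(1) \<open>a \<in> V\<close> x carr by auto
      have "inv x = a \<otimes> inv (a \<otimes> x)"
        using ax \<open>a \<in> V\<close> x(1) carr by (simp add: inv_mult)
      then show False using x ax n \<open>a \<in> V\<close> by auto
    qed
    then show ?thesis using x \<open>a \<in> V\<close> by (auto simp: m_def)
  qed
  have ideal_V: "ideal I (F\<lparr>carrier := V\<rparr>) \<longleftrightarrow>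
      I \<subseteq> V \<and> \<zero> \<in> I \<and> (\<forall>x\<in>I. \<forall>y\<in>I. x \<oplus> y \<in> I) \<and> (\<forall>a\<in>V. \<forall>x\<in>I. a \<otimes> x \<in> I)" for I
    by (rule subring_ideal_iff[OF sub])
  \<comment> \<open>If \<open>x/y\<close> lies in \<open>V\<close>, then \<open>x \<oplus> y\<close>
    is a multiple of \<open>y\<close> in \<open>V\<close>. For nonzero \<open>x\<close> and
    \<open>y\<close>, the valuation property gives this up to exchanging them.\<close>
  have add1: "x \<oplus> y \<in> m" if xy: "x \<in> m" "y \<in> m" "x \<otimes> inv y \<in> V" "y \<noteq> \<zero>" for x y
  proof -
    have c: "x \<in> carrier F" "y \<in> carrier F" using xy carr by (auto simp: m_def)
    have "x \<oplus> y = (x \<otimes> inv y \<oplus> \<one>) \<otimes> y" using c xy(4) by (simp add: l_distr m_assoc)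
    then show ?thesis using mult[of "x \<otimes> inv y \<oplus> \<one>" y] xy by simp
  qed
  have add: "x \<oplus> y \<in> m" if xy: "x \<in> m" "y \<in> m" for x y
  proof (cases "x = \<zero> \<or> y = \<zero>")
    case True
    then show ?thesis using xy carr by (auto simp: m_def)
  next
    case False
    have c: "x \<in> carrier F" "y \<in> carrier F" using xy carr by (auto simp: m_def)
    have "inv (x \<otimes> inv y) = y \<otimes> inv x"
      using c False by (intro inv_divide) auto
    then have "x \<otimes> inv y \<in> V \<or> y \<otimes> inv x \<in> V"
      using val[of "x \<otimes> inv y"] c False by (simp add: integral_iff)
    then show ?thesis
      using add1[of x y] add1[of y x] xy False a_comm[OF c] by auto
  qed
  have m_ideal: "ideal m (F\<lparr>carrier := V\<rparr>)"
    unfolding ideal_V using mult add by (auto simp: m_def)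
  have one: "\<one> \<notin> m" by (simp add: m_def)
  have proper_sub: "I \<subseteq> m" if I: "ideal I (F\<lparr>carrier := V\<rparr>)" "I \<noteq> V" for I
  proof
    fix x assume "x \<in> I"
    have IV: "I \<subseteq> V" and Im: "\<And>a y. a \<in> V \<Longrightarrow> y \<in> I \<Longrightarrow> a \<otimes> y \<in> I"
      using I(1) unfolding ideal_V by auto
    have False if n: "x \<noteq> \<zero>" "inv x \<in> V"
    proof -
      have xc: "x \<in> carrier F" using IV \<open>x \<in> I\<close> carr by auto
      then have "\<one> \<in> I" using Im[OF n(2) \<open>x \<in> I\<close>] n(1) by simp
      then have "y \<in> I" if "y \<in> V" for y using Im[OF that, of \<one>] carr[OF that] by simp
      then show False using IV I(2) by blast
    qed
    then show "x \<in> m" using IV \<open>x \<in> I\<close> by (auto simp: m_def)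
  qed
  have "(THE M. maximalideal M (F\<lparr>carrier := V\<rparr>)) = m"
  proof (rule the_equality)
    show "maximalideal m (F\<lparr>carrier := V\<rparr>)"
    proof (rule maximalidealI)
      show "carrier (F\<lparr>carrier := V\<rparr>) \<noteq> m" 
        using one subringE(3)[OF sub] by auto
      show "J = m \<or> J = carrier (F\<lparr>carrier := V\<rparr>)"
        if "ideal J (F\<lparr>carrier := V\<rparr>)" "m \<subseteq> J" for J
        using proper_sub[OF that(1)] that(2) by auto
    qed (rule m_ideal)
  next
    fix M assume "maximalideal M (F\<lparr>carrier := V\<rparr>)"
    then interpret M: maximalideal M "F\<lparr>carrier := V\<rparr>" .
    have "M \<noteq> V" using M.I_notcarr by auto
    then have "M \<subseteq> m" using proper_sub[OF M.ideal_axioms] by blast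
    moreover have "m \<subseteq> carrier (F\<lparr>carrier := V\<rparr>)" by (auto simp: m_def)
    ultimately have "m = M \<or> m = V" using M.I_maximal[OF m_ideal] by simp
    then show "M = m" using one by auto
  qed
  then show ?thesis using AV by (auto simp: center_def m_def)
qed

lemma center_localization:
  assumes M: "M \<in> t_Max F A"
  shows "center F A (localization F A M) = M"
proof -
  have "x = \<zero> \<or> inv x \<notin> localization F A M \<longleftrightarrow> x \<in> M" if x: "x \<in> A" for x
  proof (cases "x = \<zero>")
    case False
    show ?thesis
    proof
      assume "x = \<zero> \<or> inv x \<notin> localization F A M"
      then have "inv x \<notin> localization F A M" using False by simp
      then show "x \<in> M" using localizationI[OF M, of "inv x" x] False x by auto
    next
      assume xM: "x \<in> M"
      have "inv x \<notin> localization F A M"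
      proof
        assume "inv x \<in> localization F A M"
        then obtain s where s: "s \<in> A" "s \<notin> M" "s \<otimes> inv x \<in> A" by (rule localizationE[OF _ M])
        have "s = x \<otimes> (s \<otimes> inv x)" using s x False by (simp add: m_lcomm)
        then show False using t_Max_mult[OF M x s(3)] xM s by simp
      qed
      then show "x = \<zero> \<or> inv x \<notin> localization F A M" by simp
    qed
  qed (simp add: t_MaxD(4)[OF M])
  then show ?thesis
    unfolding center_eq[OF localization_valuation[OF M]] using t_MaxD(3)[OF M] by blast
qed

section \<open>Strongly irredundant members of representations\<close>

text \<open>If \<open>P\<close> were zero, it would be the only t-maximal ideal, and
  \<open>A\<close>, being the intersection of the \<open>A\<^sub>M\<close>, would equal
  \<open>A\<^sub>P = F\<close>.\<close>

lemma nonzero_in_t_Max: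
  assumes P: "P \<in> t_Max F A"
  obtains a where "a \<in> P" "a \<noteq> \<zero>"
proof (cases "P \<subseteq> {\<zero>}")
  case True
  have "x \<in> A" if x: "x \<in> carrier F" for x
  proof (rule in_A_if_in_localizations[OF x])
    fix M assume M: "M \<in> t_Max F A"
    then have "P = M" using t_Max_eq[OF P M] True t_MaxD(4)[OF M] by auto
    obtain a b where ab: "a \<in> A" "b \<in> A" "b \<noteq> \<zero>" "x = a \<otimes> inv b" using fraction[OF x] by blast
    then have "b \<otimes> x = a" by (simp add: m_lcomm)
    then show "x \<in> localization F A M"
      using localizationI[OF M x, of b] ab True \<open>P = M\<close> by auto
  qed
  then show ?thesis using proper by blast
qed (use that in blast)

lemma representation_localizations: "representation F A (localization F A ` t_Max F A)"
  unfolding representation_def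
proof (intro conjI)
  show "\<forall>V\<in>localization F A ` t_Max F A. valuation_overring F A V"
    using localization_valuation by simp
  have "A \<subseteq> localization F A M" if "M \<in> t_Max F A" for M
    using localization_valuation[OF that] by (simp add: valuation_overring_def)
  then show "A = carrier F \<inter> \<Inter>(localization F A ` t_Max F A)"
    using in_A_if_in_localizations by auto
qed

text \<open>Invertibility of the ideal generated by \<open>a\<close> and \<open>S\<close> at
  \<open>P\<close> gives \<open>k\<close> with \<open>t \<otimes> k\<close> outside \<open>P\<close>
  for some \<open>t\<close> in \<open>P\<close>, so \<open>k\<close> is not in \<open>A\<close>. At
  another \<open>M\<close>, an element of \<open>S\<close> outside \<open>M\<close> is a denominator
  of \<open>k\<close>.\<close>

lemma exists_separating_element:
  assumes P: "P \<in> t_Max F A" and S: "finite S" "S \<subseteq> P" "\<forall>M\<in>t_Max F A. S \<subseteq> M \<longrightarrow> M = P"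
    and a: "a \<in> P" "a \<noteq> \<zero>"
  obtains k where "k \<in> carrier F" "k \<notin> A" "a \<otimes> k \<in> A"
    "\<forall>M\<in>t_Max F A - {P}. k \<in> localization F A M"
proof -
  have T: "finite (insert a S)" "insert a S \<subseteq> A" "\<not> insert a S \<subseteq> {\<zero>}"
    using S a t_MaxD(3)[OF P] by auto
  obtain t k where k: "t \<in> insert a S" "k \<in> carrier F" "t \<otimes> k \<notin> P" "\<forall>u\<in>insert a S. u \<otimes> k \<in> A"
    by (rule t_invertible_at[OF T P])
  have "t \<in> P" using k(1) S a by auto
  then have "k \<notin> A" using k(3) idealD(5)[OF t_MaxD(5)[OF P]] by auto
  moreover have "a \<otimes> k \<in> A" using k(4) by simp
  moreover have "\<forall>M\<in>t_Max F A - {P}. k \<in> localization F A M"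
  proof
    fix M assume M: "M \<in> t_Max F A - {P}"
    then obtain u where u: "u \<in> S" "u \<notin> M" using S(3) by auto
    then show "k \<in> localization F A M"
      using M k T by (intro localizationI[of M k u]) auto
  qed
  ultimately show ?thesis by (rule that[OF k(2)])
qed

lemma strongly_irredundant_localization:
  assumes P: "P \<in> t_Max F A" and S: "finite S" "S \<subseteq> P" "\<forall>M\<in>t_Max F A. S \<subseteq> M \<longrightarrow> M = P"
  shows "strongly_irredundant F A (localization F A ` t_Max F A) (localization F A P)"
proof -
  define Y where "Y = localization F A ` t_Max F A"
  define V where "V = localization F A P"
  have Y': "\<exists>M\<in>t_Max F A - {P}. W = localization F A M" if "W \<in> Y - {V}" for W
    using that by (auto simp: Y_def V_def)
  have "\<not> representation F A (Y - {V})"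
  proof
    assume rep: "representation F A (Y - {V})"
    \<comment> \<open>For irredundance any nonzero \<open>a\<close> of \<open>P\<close> serves;
      below, \<open>a\<close> has to be adapted to \<open>W\<close>.\<close>
    obtain a where a: "a \<in> P" "a \<noteq> \<zero>" by (rule nonzero_in_t_Max[OF P])
    obtain k where k: "k \<in> carrier F" "k \<notin> A" "a \<otimes> k \<in> A"
      "\<forall>M\<in>t_Max F A - {P}. k \<in> localization F A M"
      by (rule exists_separating_element[OF P S a])
    have "k \<in> \<Inter>(Y - {V})" using Y' k(4) by blast
    then show False using rep k(1,2) by (auto simp: representation_def)
  qed
  moreover have "V \<in> Y" using P by (auto simp: Y_def V_def)
  moreover have "\<not> representation F A ((Y - {V}) \<union> {W})"
    if W: "valuation_overring F A W" "V \<subset> W" for W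
  proof
    assume rep: "representation F A ((Y - {V}) \<union> {W})"
    obtain w where w: "w \<in> W" "w \<notin> V" using W(2) by blast
    have sub: "subring W F" and AW: "A \<subseteq> W" using W(1) by (auto simp: valuation_overring_def)
    note val = localization_valuation[OF P, folded V_def]
    have AV: "A \<subseteq> V" using val by (simp add: valuation_overring_def)
    have wF: "w \<in> carrier F" using w subringE(1)[OF sub] by blast
    have w0: "w \<noteq> \<zero>" using w AV by auto
    then have "inv w \<in> V" using val w wF by (auto simp: valuation_overring_def)
    then obtain s where s: "s \<in> A" "s \<notin> P" "s \<otimes> inv w \<in> A"
      unfolding V_def by (rule localizationE[OF _ P])
    \<comment> \<open>\<open>a\<close> is a nonunit of \<open>A\<^sub>P\<close> with inverse
      \<open>w/s\<close> in \<open>W\<close>. Thus \<open>a \<otimes> k\<close> in \<open>A\<close>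
      puts \<open>k\<close> into \<open>W\<close>, although \<open>k\<close> is not in
      \<open>A\<close>.\<close>
    define a where "a = s \<otimes> inv w"
    have s0: "s \<noteq> \<zero>" using s t_MaxD(4)[OF P] by auto
    have aw: "a \<otimes> w = s" using s w0 wF by (simp add: a_def m_assoc)
    have aP: "a \<in> P"
    proof (rule ccontr)
      assume "a \<notin> P"
      then have "w \<in> V" unfolding V_def using s aw wF by (intro localizationI[OF P wF, of a]) (auto simp: a_def)
      then show False using w by simp
    qed
    have a0: "a \<noteq> \<zero>" using aw s0 wF by auto
    obtain k where k: "k \<in> carrier F" "k \<notin> A" "a \<otimes> k \<in> A"
      "\<forall>M\<in>t_Max F A - {P}. k \<in> localization F A M"
      by (rule exists_separating_element[OF P S aP a0])
    have aF: "a \<in> carrier F" using s wF w0 by (auto simp: a_def)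
    have "inv s \<in> V"
      unfolding V_def using s s0 by (intro localizationI[OF P, of _ s]) auto
    then have "inv s \<in> W" using W by auto
    have "w \<otimes> (inv s \<otimes> (a \<otimes> k)) \<in> W"
      using subringE(6)[OF sub] w(1) \<open>inv s \<in> W\<close> subsetD[OF AW k(3)] by simp
    moreover have "w \<otimes> (inv s \<otimes> (a \<otimes> k)) = (a \<otimes> w) \<otimes> inv s \<otimes> k"
      using wF s s0 aF k(1) by (simp del: inv_r inv_l mult_inv_cancel add: m_ac)
    ultimately have "k \<in> W" using s s0 k(1) by (simp add: aw)
    then have "k \<in> \<Inter>((Y - {V}) \<union> {W})" using Y' k(4) by blast
    then show False using rep k(1,2) by (auto simp: representation_def)
  qed
  ultimately show ?thesis
    unfolding Y_def[symmetric] V_def[symmetric] strongly_irredundant_def irredundant_def by blast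
qed

lemma strongly_irredundant_imp:
  assumes Y: "representation F A Y" and V: "strongly_irredundant F A Y V"
  obtains M S where "M \<in> t_Max F A" "V = localization F A M" "finite S" "S \<subseteq> M"
    "\<forall>N\<in>t_Max F A. S \<subseteq> N \<longrightarrow> N = M"
proof -
  have VY: "V \<in> Y" and irr: "\<not> representation F A (Y - {V})"
    and strong: "\<And>W. valuation_overring F A W \<Longrightarrow> V \<subset> W \<Longrightarrow> \<not> representation F A ((Y - {V}) \<union> {W})"
    using V by (auto simp: strongly_irredundant_def irredundant_def)
  have val: "valuation_overring F A W" if "W \<in> Y" for W using Y that unfolding representation_def by blast
  note valV = val[OF VY]
  have subV: "subring V F" "A \<subseteq> V" using valV by (auto simp: valuation_overring_def)
  have VF: "V \<subseteq> carrier F" by (rule subringE(1)[OF subV(1)])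
  define B where "B = carrier F \<inter> \<Inter>(Y - {V})"
  have A_eq: "A = V \<inter> B"
  proof -
    have "A = carrier F \<inter> \<Inter>Y" using Y unfolding representation_def by (rule conjunct2)
    also have "\<Inter>Y = V \<inter> \<Inter>(Y - {V})" using VY by blast
    finally show ?thesis using VF by (auto simp: B_def)
  qed
  have B_mult: "a \<otimes> x \<in> B" if "a \<in> A" "x \<in> B" for a x
  proof -
    have "a \<otimes> x \<in> W" if "W \<in> Y - {V}" for W
    proof -
      have "subring W F" "A \<subseteq> W" using val[of W] that by (auto simp: valuation_overring_def)
      then show ?thesis
        using subringE(6)[of W F a x] that \<open>a \<in> A\<close> \<open>x \<in> B\<close> by (auto simp: B_def)
    qed
    then show ?thesis using that by (auto simp: B_def)
  qed
  have V_mult: "a \<otimes> x \<in> V" if "a \<in> A" "x \<in> V" for a x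
    using subringE(6)[OF subV(1)] subV(2) that by blast
  have V_subset: "V \<subseteq> localization F A M"
    if x: "x \<in> B" "x \<notin> localization F A M" and M: "M \<in> t_Max F A" for x M
  proof (rule ccontr)
    assume "\<not> ?thesis"
    then obtain y where y: "y \<in> V" "y \<notin> localization F A M" by blast
    have AM: "A \<subseteq> localization F A M"
      and valM: "\<forall>x\<in>carrier F - {\<zero>}. x \<in> localization F A M \<or> inv x \<in> localization F A M"
      using localization_valuation[OF M] by (auto simp: valuation_overring_def)
    have xF: "x \<in> carrier F" "x \<noteq> \<zero>" using x AM by (auto simp: B_def)
    have yF: "y \<in> carrier F" "y \<noteq> \<zero>" using y AM VF by auto
    \<comment> \<open>With \<open>s\<close> outside \<open>M\<close> clearing the denominator of
      \<open>x/y\<close>, the product \<open>s \<otimes> x\<close> is a multiple of \<open>y\<close>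
      and so lies in \<open>V\<close>. It also lies in \<open>B\<close>, hence in \<open>A\<close>,
      which puts \<open>x\<close> into \<open>A\<^sub>M\<close>. The case of \<open>y/x\<close> is
      symmetric.\<close>
    have div: "s \<otimes> u = (s \<otimes> (u \<otimes> inv v)) \<otimes> v"
      if "s \<in> A" "u \<in> carrier F" "v \<in> carrier F" "v \<noteq> \<zero>" for s u v
      using that by (simp add: m_assoc)
    consider "x \<otimes> inv y \<in> localization F A M" | "y \<otimes> inv x \<in> localization F A M"
      using bspec[OF valM, of "x \<otimes> inv y"] xF yF by (auto simp: inv_divide integral_iff)
    then show False
    proof cases
      case 1
      then obtain s where s: "s \<in> A" "s \<notin> M" "s \<otimes> (x \<otimes> inv y) \<in> A" by (rule localizationE[OF _ M])
      have "s \<otimes> x \<in> V" using V_mult[OF s(3) y(1)] div[OF s(1) xF(1) yF] by simp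
      then have "s \<otimes> x \<in> A" using B_mult[OF s(1) x(1)] A_eq by blast
      then show False using localizationI[OF M xF(1), of s] s x by simp
    next
      case 2
      then obtain s where s: "s \<in> A" "s \<notin> M" "s \<otimes> (y \<otimes> inv x) \<in> A" by (rule localizationE[OF _ M])
      have "s \<otimes> y \<in> B" using B_mult[OF s(3) x(1)] div[OF s(1) yF(1) xF] by simp
      then have "s \<otimes> y \<in> A" using V_mult[OF s(1) y(1)] A_eq by blast
      then show False using localizationI[OF M yF(1), of s] s y by simp
    qed
  qed
  have "A \<noteq> B" using irr val by (auto simp: representation_def B_def)
  then obtain x where x: "x \<in> B" "x \<notin> A" using A_eq by blast
  have xF: "x \<in> carrier F" using x by (simp add: B_def)
  obtain M where M: "M \<in> t_Max F A" and xM: "x \<notin> localization F A M"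
    using in_A_if_in_localizations[OF xF] x by blast
  note VM = V_subset[OF x(1) xM M]
  \<comment> \<open>By \<open>V_subset\<close> such an \<open>N\<close> satisfies
    \<open>V \<subseteq> A\<^sub>N\<close>, and \<open>V\<close> lies in at most one of these
    localizations.\<close>
  have unique: "N = M" if "N \<in> t_Max F A" "z \<in> B" "z \<notin> localization F A N" for N z
    using t_Max_eq_if_valuation_subset[OF valV M VM that(1)] V_subset[OF that(2,3,1)] by simp
  have "V = localization F A M"
  proof (rule ccontr)
    assume "V \<noteq> localization F A M"
    then have "V \<subset> localization F A M" using VM by blast
    note strong[OF localization_valuation[OF M] this]
    \<comment> \<open>\<open>B\<close> lies in every \<open>A\<^sub>N\<close> with \<open>N\<close>
      different from \<open>M\<close>, so \<open>V\<close> could be replaced by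
      \<open>A\<^sub>M\<close> in \<open>Y\<close>.\<close>
    moreover have "A = B \<inter> localization F A M"
    proof
      show "A \<subseteq> B \<inter> localization F A M" using A_eq VM by blast
      show "B \<inter> localization F A M \<subseteq> A"
      proof
        fix z assume z: "z \<in> B \<inter> localization F A M"
        show "z \<in> A"
        proof (rule in_A_if_in_localizations)
          show "z \<in> carrier F" using z by (simp add: B_def)
          show "z \<in> localization F A N" if "N \<in> t_Max F A" for N
            using unique[OF that, of z] z by blast
        qed
      qed
    qed
    then have "A = carrier F \<inter> \<Inter>((Y - {V}) \<union> {localization F A M})" by (auto simp: B_def)
    then have "representation F A ((Y - {V}) \<union> {localization F A M})"
      using val localization_valuation[OF M] unfolding representation_def by blast
    ultimately show False by simp
  qed
  obtain a b where ab: "a \<in> A" "b \<in> A" "b \<noteq> \<zero>" "x = a \<otimes> inv b" using fraction[OF xF] by blast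
  then have bx: "b \<otimes> x = a" by (simp add: m_lcomm)
  have T: "finite {a, b}" "{a, b} \<subseteq> A" "\<not> {a, b} \<subseteq> {\<zero>}" using ab by simp_all
  obtain K where K: "finite K" "K \<subseteq> colon F A {a, b}"
    and nK: "\<forall>M\<in>t_Max F A. \<exists>t\<in>{a, b}. \<exists>k\<in>K. t \<otimes> k \<notin> M"
    using t_invertible_finite[OF T] by blast
  have k: "k \<in> carrier F" "a \<otimes> k \<in> A" "b \<otimes> k \<in> A" "(b \<otimes> k) \<otimes> x = a \<otimes> k" if "k \<in> K" for k
  proof -
    show kF: "k \<in> carrier F" using that K by (auto simp: colon_def)
    show "a \<otimes> k \<in> A" "b \<otimes> k \<in> A"
      using that K ab(1,2) kF m_comm[of k a] m_comm[of k b] by (auto simp: colon_def)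
    show "(b \<otimes> k) \<otimes> x = a \<otimes> k"
      unfolding bx[symmetric] using kF ab(2) xF by (simp add: m_ac)
  qed
  \<comment> \<open>Each element \<open>b \<otimes> k\<close> is a denominator of
    \<open>x = a/b\<close>, so it must lie in \<open>M\<close>, as \<open>x\<close> is not in
    \<open>A\<^sub>M\<close>.\<close>
  define S where "S = (\<lambda>k. b \<otimes> k) ` K"
  have "S \<subseteq> M"
  proof
    fix d assume "d \<in> S"
    then obtain k where "k \<in> K" "d = b \<otimes> k" by (auto simp: S_def)
    then show "d \<in> M" using k[of k] xM localizationI[OF M xF, of d] by auto
  qed
  moreover have "N = M" if N: "N \<in> t_Max F A" "S \<subseteq> N" for N
  proof (rule unique[OF N(1) x(1)], rule notI)
    assume "x \<in> localization F A N"
    then obtain s where s: "s \<in> A" "s \<notin> N" "s \<otimes> x \<in> A" by (rule localizationE[OF _ N(1)])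
    obtain t l where l: "t \<in> {a, b}" "l \<in> K" "t \<otimes> l \<notin> N" using bspec[OF nK N(1)] by blast
    \<comment> \<open>By the choice of \<open>K\<close> some product is outside \<open>N\<close>.
      Those with \<open>b\<close> are inside, so it is \<open>a \<otimes> l\<close>, and a
      denominator \<open>s\<close> of \<open>x\<close> outside \<open>N\<close> contradicts the
      primeness of \<open>N\<close>.\<close>
    have bN: "b \<otimes> l \<in> N" using N(2) l(2) by (auto simp: S_def)
    then have aN: "a \<otimes> l \<notin> N" using l by auto
    have "s \<otimes> (a \<otimes> l) = (s \<otimes> x) \<otimes> (b \<otimes> l)"
      unfolding k(4)[OF l(2), symmetric] using s xF ab(2) k(1)[OF l(2)] by (simp add: m_ac)
    then have "s \<otimes> (a \<otimes> l) \<in> N" using bN s k(3)[OF l(2)] by (simp add: t_Max_mult[OF N(1)])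
    then show False using aN s k(2)[OF l(2)] by (simp add: t_Max_mult[OF N(1)])
  qed
  ultimately show ?thesis
    using that[OF M \<open>V = localization F A M\<close>, of S] K(1) by (simp add: S_def)
qed

text \<open>A t-maximal ideal contains a finitely generated ideal exactly when it contains a finite
  generating set, which gives the same finite condition as in
  \<open>isolated_in_t_Max_iff\<close>.\<close>

lemma fg_ideal_condition_iff:
  assumes P: "P \<in> t_Max F A"
  shows "(\<exists>J. fg_ideal R J \<and> J \<subseteq> P \<and> (\<forall>M\<in>t_Max F A. M \<noteq> P \<longrightarrow> \<not> J \<subseteq> M)) \<longleftrightarrow>
    (\<exists>S. finite S \<and> S \<subseteq> P \<and> (\<forall>M\<in>t_Max F A. S \<subseteq> M \<longrightarrow> M = P))" (is "?L \<longleftrightarrow> ?R")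
proof
  assume ?L
  then obtain S where S: "finite S" "S \<subseteq> A" "Idl\<^bsub>R\<^esub> S \<subseteq> P"
    "\<forall>M\<in>t_Max F A. M \<noteq> P \<longrightarrow> \<not> Idl\<^bsub>R\<^esub> S \<subseteq> M"
    by (auto simp: fg_ideal_def)
  then show ?R using Idl_subset_iff[OF S(2) t_MaxD(5)] P by (intro exI[of _ S]) auto
next
  assume ?R
  then obtain S where S: "finite S" "S \<subseteq> P" "\<forall>M\<in>t_Max F A. S \<subseteq> M \<longrightarrow> M = P" by blast
  have SA: "S \<subseteq> A" using S t_MaxD(3)[OF P] by simp
  have iff: "Idl\<^bsub>R\<^esub> S \<subseteq> M \<longleftrightarrow> S \<subseteq> M" if "M \<in> t_Max F A" for M
    by (rule Idl_subset_iff[OF SA t_MaxD(5)[OF that]])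
  show ?L
  proof (intro exI[of _ "Idl\<^bsub>R\<^esub> S"] conjI ballI impI)
    show "fg_ideal R (Idl\<^bsub>R\<^esub> S)" using S(1) SA by (auto simp: fg_ideal_def)
    show "Idl\<^bsub>R\<^esub> S \<subseteq> P" using iff[OF P] S(2) by simp
    show "\<not> Idl\<^bsub>R\<^esub> S \<subseteq> M" if "M \<in> t_Max F A" "M \<noteq> P" for M
      using iff[OF that(1)] S(3) that by blast
  qed
qed

end

theorem theorem6p4:
  fixes F :: "('a, 'b) ring_scheme" and A V P :: "'a set"
  assumes "PvMD F A"
    and "carrier F \<noteq> A"
    and "valuation_overring F A V"
    and "P = center F A V"
  shows "((\<exists>Y. representation F A Y \<and> strongly_irredundant F A Y V)
          \<longleftrightarrow> V = localization F A P \<and> P \<in> t_Max F A \<and> isolated_in_t_Max F A P)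
       \<and> (V = localization F A P \<and> P \<in> t_Max F A \<and> isolated_in_t_Max F A P
          \<longleftrightarrow> V = localization F A P \<and> P \<in> t_Max F A \<and>
              (\<exists>J. fg_ideal (F\<lparr>carrier := A\<rparr>) J \<and> J \<subseteq> P \<and>
                   (\<forall>M\<in>t_Max F A. M \<noteq> P \<longrightarrow> \<not> J \<subseteq> M)))"
proof -
  have quot: "quotient_field F A" using assms(1) by (simp add: PvMD_def)
  then have "field F" by (simp add: quotient_field_def)
  interpret proper_PvMD F A
    by (intro proper_PvMD.intro fraction_field.intro fraction_field_axioms.intro
        proper_PvMD_axioms.intro) (fact \<open>field F\<close> quot assms)+
  have "(\<exists>Y. representation F A Y \<and> strongly_irredundant F A Y V)
      \<longleftrightarrow> V = localization F A P \<and> P \<in> t_Max F A \<and> isolated_in_t_Max F A P" (is "?L \<longleftrightarrow> ?R")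
  proof
    assume ?L
    then obtain Y where Y: "representation F A Y" "strongly_irredundant F A Y V" by blast
    obtain M S where M: "M \<in> t_Max F A" "V = localization F A M"
      and S: "finite S" "S \<subseteq> M" "\<forall>N\<in>t_Max F A. S \<subseteq> N \<longrightarrow> N = M"
      by (rule strongly_irredundant_imp[OF Y])
    \<comment> \<open>The center of \<open>A\<^sub>M\<close> is \<open>M\<close>, which identifies
      the ideal just found with the given \<open>P\<close>.\<close>
    have "P = M" using assms(4) center_localization[OF M(1)] M(2) by simp
    then show ?R using M S isolated_in_t_Max_iff[OF M(1)] by blast
  next
    assume ?R
    then have V: "V = localization F A P" and P: "P \<in> t_Max F A" and "isolated_in_t_Max F A P" by auto
    then obtain S where S: "finite S" "S \<subseteq> P" "\<forall>M\<in>t_Max F A. S \<subseteq> M \<longrightarrow> M = P"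
      using isolated_in_t_Max_iff[OF P] by blast
    show ?L using representation_localizations strongly_irredundant_localization[OF P S] V by blast
  qed
  moreover have "isolated_in_t_Max F A P \<longleftrightarrow> (\<exists>J. fg_ideal (F\<lparr>carrier := A\<rparr>) J \<and> J \<subseteq> P \<and>
      (\<forall>M\<in>t_Max F A. M \<noteq> P \<longrightarrow> \<not> J \<subseteq> M))" if "P \<in> t_Max F A"
    unfolding isolated_in_t_Max_iff[OF that] fg_ideal_condition_iff[OF that] ..
  ultimately show ?thesis by (intro conjI) metis+
qed

end
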